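(* Let $s\in[12,15+25/512]$ and suppose that $X\in\mathbf{SMALL}$. Then $\mathcal{E}_{R_s}(X^* )\le\mathcal{E}_{R_s}(X)$, with equality if and only if $X=X^*$.
   Context: For a finite set $P=\{P_1,\dots,P_5\}$ of $5$ distinct points of the unit sphere $S^2\subset\mathbb{R}^3$ and $f:(0,2]\to\mathbb{R}$, $\mathcal{E}_f(P)=\sum_{i<j}f(\|P_i-P_j\|)$. For $s>0$, $R_s(r)=r^{-s}$. Stereographic projection is $\Sigma(x,y,z)=\left(\frac{x}{1-z},\frac{y}{1-z}\right)$. A $4$-tuple $(p_0,p_1,p_2,p_3)$ of points of $\mathbb{R}^2$ represents the $5$-point configuration $\{\Sigma^{-1}(p_0),\Sigma^{-1}(p_1),\Sigma^{-1}(p_2),\Sigma^{-1}(p_3),(0,0,1)\}$. Write $p_k=(p_{k1},p_{k2})$. $\mathbf{SMALL}$ is the set of $5$-point configurations represented by $4$-tuples such that: (1) $\|p_0\|\ge\|p_k\|$ for $k=1,2,3$; (2) $512p_0\in[433,498]\times\{0\}$; (3) $512p_1\in[-16,16]\times[-464,-349]$; (4) $512p_2\in[-498,-400]\times[0,24]$; (5) $512p_3\in[-16,16]\times[349,464]$. The map $X\mapsto X^*$: given $X\in\mathbf{SMALL}$ represented by $(p_0,p_1,p_2,p_3)$, let $(p_0',p_1',p_2',p_3')$ be obtained by rotating all four points about the origin of $\mathbb{R}^2$ so that $p_0'$ and $p_2'$ lie on the same horizontal line with $p_0'$ lying to the right of $p_2'$. Then $X^*$ is the configuration represented by $(p_0^*,p_1^*,p_2^*,p_3^*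 )$ where $$p_0^*=-p_2^*=\left(\frac{p'_{01}-p'_{21}}{2},0\right),\qquad p_1^*=-p_3^*=\left(0,\frac{p'_{12}-p'_{32}}{2}\right).$$ *)

theory Defs
  imports "HOL-Analysis.Analysis"
begin

section \<open>Energy of a finite point set\<close>

text \<open>Each unordered pair of distinct points occurs twice in the double sum.\<close>

definition energy :: "(real \<Rightarrow> real) \<Rightarrow> (real^3) set \<Rightarrow> real" where
  "energy f P = (\<Sum>A\<in>P. \<Sum>B\<in>P - {A}. f (norm (A - B))) / 2"

definition riesz :: "real \<Rightarrow> real \<Rightarrow> real" where
  "riesz s r = r powr (- s)"

lemma energy_enumeration:
  fixes P :: "nat \<Rightarrow> real^3"
  assumes "inj_on P {..<n}"
  shows "energy f (P ` {..<n}) = (\<Sum>j<n. \<Sum>i<j. f (norm (P i - P j)))"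
proof -
  let ?g = "\<lambda>i j. f (norm (P i - P j))"
  have inner: "(\<Sum>B\<in>P ` {..<n} - {P i}. f (norm (P i - B))) = (\<Sum>j\<in>{..<n} - {i}. ?g i j)"
    if "i < n" for i
  proof -
    have "P ` {..<n} - {P i} = P ` ({..<n} - {i})"
      using assms that by (auto simp: inj_on_def)
    moreover have "inj_on P ({..<n} - {i})"
      using assms by (rule inj_on_subset) auto
    ultimately show ?thesis
      by (simp add: sum.reindex)
  qed
  have "(\<Sum>A\<in>P ` {..<n}. \<Sum>B\<in>P ` {..<n} - {A}. f (norm (A - B))) =
        (\<Sum>i<n. \<Sum>j\<in>{..<n} - {i}. ?g i j)"
    by (simp add: sum.reindex[OF assms] inner)
  also have "\<dots> = 2 * (\<Sum>j<n. \<Sum>i<j. ?g i j)"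
  proof (induction n)
    case 0
    show ?case by simp
  next
    case (Suc n)
    have "(\<Sum>j\<in>{..<Suc n} - {i}. ?g i j) = (\<Sum>j\<in>{..<n} - {i}. ?g i j) + ?g i n" if "i < n" for i
    proof -
      have "{..<Suc n} - {i} = insert n ({..<n} - {i})"
        using that by auto
      then show ?thesis by simp
    qed
    moreover have "{..<Suc n} - {n} = {..<n}"
      by auto
    ultimately have "(\<Sum>i<Suc n. \<Sum>j\<in>{..<Suc n} - {i}. ?g i j) =
        (\<Sum>i<n. \<Sum>j\<in>{..<n} - {i}. ?g i j) + (\<Sum>i<n. ?g i n) + (\<Sum>i<n. ?g n i)"
      by (simp add: sum.distrib)
    also have "(\<Sum>i<n. ?g n i) = (\<Sum>i<n. ?g i n)"
      by (simp add: norm_minus_commute)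
    finally show ?case
      using Suc by simp
  qed
  finally show ?thesis
    by (simp add: energy_def)
qed


section \<open>Stereographic projection and representing tuples\<close>

definition north_pole :: "real^3" where
  "north_pole = vector [0, 0, 1]"

definition stereo :: "real^3 \<Rightarrow> real^2" where
  "stereo P = vector [P $ 1 / (1 - P $ 3), P $ 2 / (1 - P $ 3)]"

definition inv_stereo :: "real^2 \<Rightarrow> real^3" where
  "inv_stereo = the_inv_into (sphere 0 1 - {north_pole}) stereo"

type_synonym quad = "(real^2) \<times> (real^2) \<times> (real^2) \<times> (real^2)"

definition five_point_configs :: "(real^3) set set" where
  "five_point_configs = {P. P \<subseteq> sphere 0 1 \<and> card P = 5}"

fun config :: "quad \<Rightarrow> (real^3) set" where
  "config (p0, p1, p2, p3) =
     {inv_stereo p0, inv_stereo p1, inv_stereo p2, inv_stereo p3, north_pole}"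


section \<open>The set SMALL\<close>

fun small_quad :: "quad \<Rightarrow> bool" where
  "small_quad (p0, p1, p2, p3) \<longleftrightarrow>
     norm p1 \<le> norm p0 \<and> norm p2 \<le> norm p0 \<and> norm p3 \<le> norm p0 \<and>
     512 * p0 $ 1 \<in> {433..498} \<and> 512 * p0 $ 2 = 0 \<and>
     512 * p1 $ 1 \<in> {-16..16} \<and> 512 * p1 $ 2 \<in> {-464..-349} \<and>
     512 * p2 $ 1 \<in> {-498..-400} \<and> 512 * p2 $ 2 \<in> {0..24} \<and>
     512 * p3 $ 1 \<in> {-16..16} \<and> 512 * p3 $ 2 \<in> {349..464}"

definition SMALL :: "(real^3) set set" where
  "SMALL = {X \<in> five_point_configs. \<exists>p. small_quad p \<and> X = config p}"


section \<open>Symmetrization\<close>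

fun aligning_rotation :: "quad \<Rightarrow> real^2^2 \<Rightarrow> bool" where
  "aligning_rotation (p0, p1, p2, p3) Q \<longleftrightarrow>
     rotation_matrix Q \<and> (Q *v p0) $ 2 = (Q *v p2) $ 2 \<and> (Q *v p2) $ 1 < (Q *v p0) $ 1"

fun rotate_quad :: "real^2^2 \<Rightarrow> quad \<Rightarrow> quad" where
  "rotate_quad Q (p0, p1, p2, p3) = (Q *v p0, Q *v p1, Q *v p2, Q *v p3)"

fun symm_quad :: "quad \<Rightarrow> quad" where
  "symm_quad (p0, p1, p2, p3) =
     (let a = vector [(p0 $ 1 - p2 $ 1) / 2, 0];
          b = vector [0, (p1 $ 2 - p3 $ 2) / 2]
      in (a, b, - a, - b))"

definition star_quad :: "quad \<Rightarrow> quad" where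
  "star_quad p = symm_quad (rotate_quad (THE Q. aligning_rotation p Q) p)"

text \<open>
  The tuple and the rotation in the next definition are unique:
  see \<open>small_quad_unique\<close> and \<open>aligning_rotation_ex1\<close> below.
\<close>

definition star :: "(real^3) set \<Rightarrow> (real^3) set" where
  "star X = config (star_quad (THE p. small_quad p \<and> X = config p))"


section \<open>Well-definedness\<close>

lemma sphere3_iff: "P \<in> sphere 0 1 \<longleftrightarrow> (P $ 1)\<^sup>2 + (P $ 2)\<^sup>2 + (P $ 3)\<^sup>2 = 1" for P :: "real^3"
  by (simp add: norm_vec_def L2_set_def sum_3)

lemma sphere3_north_pole:
  fixes P :: "real^3"
  assumes "P \<in> sphere 0 1"
  shows "P = north_pole \<longleftrightarrow> P $ 3 = 1"
proof
  assume "P $ 3 = 1"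
  with assms have "(P $ 1)\<^sup>2 + (P $ 2)\<^sup>2 = 0"
    unfolding sphere3_iff by simp
  then have "P $ 1 = 0 \<and> P $ 2 = 0"
    by (simp add: sum_power2_eq_zero_iff)
  with \<open>P $ 3 = 1\<close> show "P = north_pole"
    by (simp add: vec_eq_iff forall_3 north_pole_def)
qed (simp add: north_pole_def)

lemma stereo_components [simp]:
  "stereo P $ 1 = P $ 1 / (1 - P $ 3)" "stereo P $ 2 = P $ 2 / (1 - P $ 3)"
  by (simp_all add: stereo_def)

definition stereo_lift :: "real^2 \<Rightarrow> real^3" where
  "stereo_lift p = (let m = (p $ 1)\<^sup>2 + (p $ 2)\<^sup>2 in
     vector [2 * p $ 1 / (1 + m), 2 * p $ 2 / (1 + m), (m - 1) / (1 + m)])"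

lemma stereo_lift_stereo:
  assumes "P \<in> sphere 0 1 - {north_pole}"
  shows "stereo_lift (stereo P) = P"
proof -
  define x y z where "x = P $ 1" and "y = P $ 2" and "z = P $ 3"
  have s: "x\<^sup>2 + y\<^sup>2 = (1 - z) * (1 + z)" and z: "1 - z \<noteq> 0"
    using assms sphere3_iff[of P] sphere3_north_pole[of P]
    by (auto simp: x_def y_def z_def algebra_simps power2_eq_square)
  define m where "m = (x / (1 - z))\<^sup>2 + (y / (1 - z))\<^sup>2"
  have "m = (x\<^sup>2 + y\<^sup>2) / (1 - z)\<^sup>2"
    by (simp add: m_def power_divide add_divide_distrib)
  also have "\<dots> = (1 + z) / (1 - z)"
    unfolding s using z by (simp add: power2_eq_square)
  finally have m: "m = (1 + z) / (1 - z)" .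
  have m1: "1 + m = 2 / (1 - z)" and m2: "m - 1 = 2 * z / (1 - z)"
    unfolding m using z by (simp_all add: field_simps)
  have "stereo_lift (stereo P) =
      vector [2 * (x / (1 - z)) / (1 + m), 2 * (y / (1 - z)) / (1 + m), (m - 1) / (1 + m)]"
    by (simp add: stereo_lift_def Let_def m_def x_def y_def z_def)
  also have "\<dots> = vector [x, y, z]"
    unfolding m1 m2 using z by simp
  also have "\<dots> = P"
    by (simp add: vec_eq_iff forall_3 x_def y_def z_def)
  finally show ?thesis .
qed

lemma stereo_lift:
  shows "stereo_lift p \<in> sphere 0 1 - {north_pole}" and "stereo (stereo_lift p) = p"
proof -
  define m where "m = (p $ 1)\<^sup>2 + (p $ 2)\<^sup>2"
  have m: "1 + m > 0"
    by (simp add: m_def add_pos_nonneg)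
  have c: "stereo_lift p $ 1 = 2 * p $ 1 / (1 + m)" "stereo_lift p $ 2 = 2 * p $ 2 / (1 + m)"
    "stereo_lift p $ 3 = (m - 1) / (1 + m)"
    by (simp_all add: stereo_lift_def m_def Let_def)
  have "(stereo_lift p $ 1)\<^sup>2 + (stereo_lift p $ 2)\<^sup>2 + (stereo_lift p $ 3)\<^sup>2 =
      (4 * m + (m - 1)\<^sup>2) / (1 + m)\<^sup>2"
    unfolding c by (simp add: m_def power_divide power_mult_distrib add_divide_distrib)
  also have "4 * m + (m - 1)\<^sup>2 = (1 + m)\<^sup>2"
    by (simp add: power2_eq_square algebra_simps)
  finally have S: "stereo_lift p \<in> sphere 0 1"
    using m unfolding sphere3_iff by simp
  have d: "1 - stereo_lift p $ 3 = 2 / (1 + m)"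
    unfolding c using m by (simp add: field_simps)
  then have "stereo_lift p $ 3 \<noteq> 1"
    using m by auto
  with S show "stereo_lift p \<in> sphere 0 1 - {north_pole}"
    using sphere3_north_pole[OF S] by simp
  show "stereo (stereo_lift p) = p"
    using m by (simp add: vec_eq_iff forall_2 d) (simp add: c)
qed

lemma bij_betw_stereo: "bij_betw stereo (sphere 0 1 - {north_pole}) UNIV"
proof (rule bij_betwI[where g = stereo_lift])
  show "stereo_lift \<in> UNIV \<rightarrow> sphere 0 1 - {north_pole}"
    using stereo_lift(1) by blast
qed (use stereo_lift_stereo stereo_lift(2) in auto)

lemma inv_stereo_eq: "inv_stereo p = stereo_lift p"
  unfolding inv_stereo_def
  by (rule the_inv_into_f_eq) (use bij_betw_stereo stereo_lift in \<open>auto simp: bij_betw_def\<close>)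

lemma inv_stereo_inject: "inv_stereo p = inv_stereo q \<longleftrightarrow> p = q"
  unfolding inv_stereo_eq by (metis stereo_lift(2))

lemma inv_stereo_neq_north_pole: "inv_stereo p \<noteq> north_pole"
  unfolding inv_stereo_eq using stereo_lift(1)[of p] by blast

lemma small_quad_unique:
  assumes "small_quad p" "small_quad q" "config p = config q"
  shows "p = q"
proof -
  obtain p0 p1 p2 p3 where p: "p = (p0, p1, p2, p3)" by (cases p)
  obtain q0 q1 q2 q3 where q: "q = (q0, q1, q2, q3)" by (cases q)
  have "config p - {north_pole} = inv_stereo ` {p0, p1, p2, p3}"
    and "config q - {north_pole} = inv_stereo ` {q0, q1, q2, q3}"
    using inv_stereo_neq_north_pole by (auto simp: p q)
  with assms(3) have "inv_stereo ` {p0, p1, p2, p3} = inv_stereo ` {q0, q1, q2, q3}"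
    by simp
  then have eq: "{p0, p1, p2, p3} = {q0, q1, q2, q3}"
    by (subst (asm) inj_image_eq_iff) (auto simp: inj_def inv_stereo_inject)
  have "p0 \<noteq> q1 \<and> p0 \<noteq> q2 \<and> p0 \<noteq> q3" "p1 \<noteq> q0 \<and> p1 \<noteq> q2 \<and> p1 \<noteq> q3"
    "p2 \<noteq> q0 \<and> p2 \<noteq> q1 \<and> p2 \<noteq> q3" "p3 \<noteq> q0 \<and> p3 \<noteq> q1 \<and> p3 \<noteq> q2"
    using assms(1,2) by (auto simp: p q)
  moreover have "p0 \<in> {q0, q1, q2, q3}" "p1 \<in> {q0, q1, q2, q3}"
    "p2 \<in> {q0, q1, q2, q3}" "p3 \<in> {q0, q1, q2, q3}"
    using eq by blast+
  ultimately show ?thesis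
    by (simp add: p q)
qed

lemma rotation_matrix_2_iff:
  "rotation_matrix (Q :: real^2^2) \<longleftrightarrow>
     Q $ 2 $ 2 = Q $ 1 $ 1 \<and> Q $ 2 $ 1 = - Q $ 1 $ 2 \<and> (Q $ 1 $ 1)\<^sup>2 + (Q $ 1 $ 2)\<^sup>2 = 1"
  (is "?L \<longleftrightarrow> ?R")
proof -
  define a b c d where "a = Q $ 1 $ 1" and "b = Q $ 1 $ 2" and "c = Q $ 2 $ 1" and "d = Q $ 2 $ 2"
  have L: "?L \<longleftrightarrow> a * a + c * c = 1 \<and> a * b + c * d = 0 \<and> b * b + d * d = 1 \<and> a * d - b * c = 1"
    by (auto simp: rotation_matrix_def orthogonal_matrix det_2 vec_eq_iff forall_2
        matrix_matrix_mult_def transpose_def mat_def sum_2 a_def b_def c_def d_def mult.commute)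
  have "(d - a)\<^sup>2 + (c + b)\<^sup>2 = 0" if ?L
    using that unfolding L by (simp add: power2_eq_square algebra_simps)
  then have "?L \<Longrightarrow> d = a \<and> c = - b"
    by (auto simp: sum_power2_eq_zero_iff)
  then have "?L \<longleftrightarrow> d = a \<and> c = - b \<and> a\<^sup>2 + b\<^sup>2 = 1"
    unfolding L by (auto simp: power2_eq_square)
  then show ?thesis
    by (simp add: a_def b_def c_def d_def)
qed

lemma aligning_rotation_ex1:
  assumes "small_quad p"
  shows "\<exists>!Q. aligning_rotation p Q"
proof -
  obtain p0 p1 p2 p3 where p: "p = (p0, p1, p2, p3)" by (cases p)
  define u v where "u = p0 $ 1 - p2 $ 1" and "v = p0 $ 2 - p2 $ 2"
  have u: "u > 0"
    using assms by (auto simp: p u_def)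
  define l where "l = sqrt (u\<^sup>2 + v\<^sup>2)"
  have uv: "u\<^sup>2 + v\<^sup>2 > 0"
    using u by (simp add: add_pos_nonneg)
  then have l: "l > 0" and l2: "l\<^sup>2 = u\<^sup>2 + v\<^sup>2"
    by (simp_all add: l_def)
  have iff: "aligning_rotation p Q \<longleftrightarrow>
      Q $ 2 $ 2 = Q $ 1 $ 1 \<and> Q $ 2 $ 1 = - Q $ 1 $ 2 \<and> (Q $ 1 $ 1)\<^sup>2 + (Q $ 1 $ 2)\<^sup>2 = 1 \<and>
      Q $ 1 $ 1 * v = Q $ 1 $ 2 * u \<and> 0 < Q $ 1 $ 1 * u + Q $ 1 $ 2 * v" for Q
    by (auto simp: p rotation_matrix_2_iff matrix_vector_mult_def sum_2 u_def v_def algebra_simps)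
  show ?thesis
  proof
    define Q where "Q = (vector [vector [u / l, v / l], vector [- v / l, u / l]] :: real^2^2)"
    have "(u / l)\<^sup>2 + (v / l)\<^sup>2 = (u\<^sup>2 + v\<^sup>2) / l\<^sup>2"
      by (simp add: power_divide add_divide_distrib)
    also have "\<dots> = 1"
      using l by (simp flip: l2)
    finally have 1: "(u / l)\<^sup>2 + (v / l)\<^sup>2 = 1" .
    have "u / l * u + v / l * v = (u\<^sup>2 + v\<^sup>2) / l"
      by (simp add: power2_eq_square add_divide_distrib)
    also have "\<dots> = l"
      unfolding l2[symmetric] using l by (simp add: power2_eq_square)
    finally have "u / l * u + v / l * v = l" .
    with 1 l show "aligning_rotation p Q"
      unfolding iff by (simp add: Q_def)
  next
    fix Q assume Q: "aligning_rotation p Q"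
    define a b where "a = Q $ 1 $ 1" and "b = Q $ 1 $ 2"
    have ab: "a\<^sup>2 + b\<^sup>2 = 1" "a * v = b * u" "0 < a * u + b * v"
      and cd: "Q $ 2 $ 2 = a" "Q $ 2 $ 1 = - b"
      using Q unfolding iff by (auto simp: a_def b_def)
    have "(a * u + b * v)\<^sup>2 = (a\<^sup>2 + b\<^sup>2) * (u\<^sup>2 + v\<^sup>2) - (a * v - b * u)\<^sup>2"
      by (simp add: power2_eq_square algebra_simps)
    also have "\<dots> = l\<^sup>2"
      using ab(1,2) l2 by simp
    finally have s: "a * u + b * v = l"
      using ab(3) l by (simp add: power2_eq_iff)
    have "a * l\<^sup>2 = u * (a * u + b * v) + v * (a * v - b * u)"
      unfolding l2 by (simp add: power2_eq_square algebra_simps)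
    then have "a = u / l"
      using s ab(2) l by (simp add: field_simps power2_eq_square)
    moreover have "b * l\<^sup>2 = v * (a * u + b * v) - u * (a * v - b * u)"
      unfolding l2 by (simp add: power2_eq_square algebra_simps)
    then have "b = v / l"
      using s ab(2) l by (simp add: field_simps power2_eq_square)
    ultimately show "Q = vector [vector [u / l, v / l], vector [- v / l, u / l]]"
      using cd by (simp add: vec_eq_iff forall_2 a_def[symmetric] b_def[symmetric])
  qed
qed

lemma star_config:
  assumes "small_quad p"
  shows "star (config p) = config (star_quad p)"
proof -
  have "(THE q. small_quad q \<and> config p = config q) = p"
    by (rule the_equality) (use assms small_quad_unique in auto)
  then show ?thesis
    by (simp add: star_def)
qed

end

theory Submission
  imports Defs
begin

text \<open>
  Put $h = s/2 \<in> [6, 7.6]$. In stereographic coordinates the energy is $4^{-h}$ times the sum of the $h$-th powers of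
  the weights $1 + |p|^2$ (bonds with the north pole) and of the bonds
  $(1 + |p|^2)(1 + |q|^2) / |p - q|^2$. All of these are invariant under rotations of the plane, so the tuple may be taken in
  aligned position, where it has the form $p_0, p_2 = (c \<plusminus> a, y)$, $p_1 = (x_1, w - b)$, $p_3 = (x_3, w + b)$.
  Symmetrization sets $c$, $y$, $w$, $x_1$, $x_3$ to zero and keeps $a$ and $b$.
  
  The ten terms are grouped so that the terms of a group whose values coincide after symmetrization stay together:
  the two weights of a pair, the single bond inside a pair, and the four cross bonds between the pairs.
  Replacing $t^h$ by its tangent at the symmetrized value turns the claim for a group into an
  inequality between first powers, that is, between rational functions:
  
    \<^item> The weights of the horizontal pair have sum $2(1 + a^2) + 2(c^2 + y^2)$, and the bond inside this pair does
    not decrease since $a \<le> 1$ (\<open>potential_gap\<close>).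
  
    \<^item> The weights of the vertical pair gain at least $8 w^2$ and a multiple of $x_1^2 + x_3^2$, even after they have
    compensated the loss in the bond inside this pair, which occurs because its points move apart
    (\<open>vertical_pair_ge\<close>).
  
    \<^item> For the cross bonds an algebraic identity (\<open>two_quotients_identity\<close>), applied to the horizontal
    pair seen from $p_1$ and from $p_3$, shows that setting $c$, $x_1$ and $x_3$ to zero does not increase the sum
    (\<open>bonds_to_horizontal_pair_ge\<close>). Applied once more, to the vertical pair, it
    bounds the remaining deficit by a small quadratic form in $y$ and $w$ (\<open>cross_bonds_ge\<close>).
  
  The sum of the cross bonds alone can really drop under a perturbation in $y$ and $w$ when $a$ is near $1$ and $b$ is small,
  because the coefficient of $w^2$ is then nearly zero. So the deficit has to be paid by
  the gains of the pairs. These carry the factors $(1 + a^2)^{h-1}$ and $(1 + b^2)^{h-1}$ instead of the $(h-1)$-st power of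
  the symmetrized cross bond $(1 + a^2)(1 + b^2)/(a^2 + b^2)$, which is larger; the upper bound on $h$ keeps
  the exchange rate tolerable (\<open>cross_bonds_ge_exchanged\<close>).
  
  The total leaves a positive definite remainder in $c$, $y$, $w$, $x_1$, $x_3$ (\<open>potential_gap\<close>). Equality therefore forces the
  rotated tuple to be symmetric, with $p_0$ still on the horizontal axis, so the rotation was
  trivial and the configuration already equals its symmetrization.
\<close>

section \<open>Elementary bounds for powers and products\<close>

lemma powr_above_tangent:
  fixes x F h :: real
  assumes "x > 0" "F > 0" "h \<ge> 1"
  shows "F powr h + h * F powr (h - 1) * (x - F) \<le> x powr h"
proof -
  have "convex_on {0<..} (\<lambda>x::real. x powr h)"
    using assms(3) by (rule powr_convex)
  moreover have "((\<lambda>x. x powr h) has_field_derivative h * F powr (h - 1)) (at F within {0<..})"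
    using assms by (auto intro!: derivative_eq_intros)
  ultimately have "x powr h - F powr h \<ge> h * F powr (h - 1) * (x - F)"
    using assms by (intro convex_on_imp_above_tangent[where A = "{0<..}"]) (auto simp: interior_open)
  then show ?thesis by simp
qed

lemma powr_sum_above_two_tangents:
  fixes f g F h :: real
  assumes "f > 0" "g > 0" "F > 0" "h \<ge> 1"
  shows "2 * F powr h + h * F powr (h - 1) * (f + g - 2 * F) \<le> f powr h + g powr h"
  using powr_above_tangent[of f F h] powr_above_tangent[of g F h] assms
  by (simp add: algebra_simps)

lemma sum4_powr_above_tangent:
  fixes t1 t2 t3 t4 F h :: real
  assumes "t1 > 0" "t2 > 0" "t3 > 0" "t4 > 0" "F > 0" "h \<ge> 1" "4 * F - \<delta> \<le> t1 + t2 + t3 + t4"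
  shows "4 * F powr h - h * F powr (h - 1) * \<delta> \<le> t1 powr h + t2 powr h + t3 powr h + t4 powr h"
proof -
  have "h * F powr (h - 1) * (- \<delta>) \<le> h * F powr (h - 1) * (t1 + t2 + t3 + t4 - 4 * F)"
    using assms by (intro mult_left_mono) auto
  then show ?thesis
    using powr_sum_above_two_tangents[of t1 t2 F h] powr_sum_above_two_tangents[of t3 t4 F h] assms
    by (simp add: algebra_simps)
qed

text \<open>
  Writing $f^h$ as a power of $f^6$ before taking the tangent keeps the part of $f^6 + g^6$ that is
  quadratic in $f - g$; the tangent of $f^h$ itself would see only $f + g$. This is where $h \<ge> 6$ enters.
\<close>

lemma powr_sum_above_sixth_power_tangent:
  fixes f g F h u :: real
  assumes pos: "f > 0" "g > 0" "F > 0" and h: "h \<ge> 6"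
    and u: "2 * F ^ 6 + 6 * F ^ 5 * u \<le> f ^ 6 + g ^ 6"
  shows "2 * F powr h + h * F powr (h - 1) * u \<le> f powr h + g powr h"
proof -
  have p: "(x ^ 6) powr (h / 6) = x powr h" if "x > 0" for x :: real
    using that powr_powr[of x 6 "h / 6"] by simp
  have q: "(F ^ 6) powr (h / 6 - 1) * F ^ 5 = F powr (h - 1)"
  proof -
    have "(F ^ 6) powr (h / 6 - 1) * F ^ 5 = F powr (6 * (h / 6 - 1)) * F powr 5"
      using pos powr_powr[of F 6 "h / 6 - 1"] by simp
    also have "\<dots> = F powr (h - 1)"
      unfolding powr_add[symmetric] by (rule arg_cong[where f = "(powr) F"]) simp
    finally show ?thesis .
  qed
  have "h * F powr (h - 1) * u = h / 6 * (F ^ 6) powr (h / 6 - 1) * (6 * F ^ 5 * u)"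
    unfolding q[symmetric] by simp
  also have "\<dots> \<le> h / 6 * (F ^ 6) powr (h / 6 - 1) * (f ^ 6 + g ^ 6 - 2 * F ^ 6)"
    using u h by (intro mult_left_mono) auto
  finally have "h * F powr (h - 1) * u \<le> h / 6 * (F ^ 6) powr (h / 6 - 1) * (f ^ 6 + g ^ 6 - 2 * F ^ 6)" .
  moreover have "2 * F powr h + h / 6 * (F ^ 6) powr (h / 6 - 1) * (f ^ 6 + g ^ 6 - 2 * F ^ 6) \<le> f powr h + g powr h"
    using powr_sum_above_two_tangents[of "f ^ 6" "g ^ 6" "F ^ 6" "h / 6"] pos h unfolding p[OF pos(1)] p[OF pos(2)] p[OF pos(3)] by simp
  ultimately show ?thesis by linarith
qed

text \<open>
  The gains and the deficits that have to be compared come with different bases raised to the power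
  $h - 1$. Since $h - 1 \<le> 33/5$, a lower bound $r$ on the ratio of the bases gives the rate $r^{33/5}$
  at which they can be exchanged; fifth powers make the bound checkable over the rationals.
\<close>

lemma powr_exchange_rate:
  fixes F G r t k :: real
  assumes "F \<ge> 0" "0 < r" "r \<le> 1" "r * F \<le> G" "0 \<le> t" "t \<le> 33/5" "0 \<le> k" "k ^ 5 \<le> r ^ 33"
  shows "k * F powr t \<le> G powr t"
proof -
  have "k = (k ^ 5) powr (1/5)"
    using assms(7) powr_powr[of k 5 "1/5"] by simp
  also have "\<dots> \<le> (r ^ 33) powr (1/5)"
    using assms by (intro powr_mono2) auto
  also have "\<dots> = r powr (33/5)"
    using assms(2) powr_powr[of r 33 "1/5"] by simp
  also have "\<dots> \<le> r powr t"
    using assms by (intro powr_mono') auto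
  finally have "k * F powr t \<le> r powr t * F powr t"
    by (intro mult_right_mono) auto
  also have "\<dots> = (r * F) powr t"
    by (simp add: powr_mult)
  also have "\<dots> \<le> G powr t"
    using assms by (intro powr_mono2) auto
  finally show ?thesis .
qed

lemma square_le_of_abs_le:
  fixes t r :: real
  assumes "\<bar>t\<bar> \<le> r"
  shows "t\<^sup>2 \<le> r\<^sup>2"
  using power_mono[OF assms, of 2] by simp

lemma abs_mult_le:
  fixes x y r s :: real
  assumes "\<bar>x\<bar> \<le> r" "\<bar>y\<bar> \<le> s"
  shows "\<bar>x * y\<bar> \<le> r * s"
  unfolding abs_mult using assms by (intro mult_mono) auto

section \<open>Bonds between the horizontal and the vertical pair\<close>

text \<open>
  Up to the weight of the point, the two quotients are the bonds from one point to the two ends of a segment of half-length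
  $a$, where $c$ and $\<xi>$ shift the segment against the origin and against the point. The identity isolates
  the excess over the unshifted value $2L/N$ as one square, one manifestly nonnegative term, and
  one term in $\<xi>^2$ whose coefficient decides the sign.
\<close>

lemma two_quotients_identity:
  fixes a c \<xi> L N :: real
  assumes "N \<noteq> 0" "N + \<xi>\<^sup>2 - 2 * a * \<xi> \<noteq> 0" "N + \<xi>\<^sup>2 + 2 * a * \<xi> \<noteq> 0"
  shows "(L + c\<^sup>2 + 2 * a * c) / (N + \<xi>\<^sup>2 - 2 * a * \<xi>) + (L + c\<^sup>2 - 2 * a * c) / (N + \<xi>\<^sup>2 + 2 * a * \<xi>) =
    2 * L / N + 2 * ((c * N + 2 * a\<^sup>2 * \<xi>)\<^sup>2 + (L * (4 * a\<^sup>2 - N - \<xi>\<^sup>2) - 4 * a ^ 4) * \<xi>\<^sup>2 + c\<^sup>2 * \<xi>\<^sup>2 * N) /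
      (N * ((N + \<xi>\<^sup>2 - 2 * a * \<xi>) * (N + \<xi>\<^sup>2 + 2 * a * \<xi>)))"
proof -
  define D E Z where "D = N + \<xi>\<^sup>2 - 2 * a * \<xi>" and "E = N + \<xi>\<^sup>2 + 2 * a * \<xi>"
    and "Z = 2 * ((c * N + 2 * a\<^sup>2 * \<xi>)\<^sup>2 + (L * (4 * a\<^sup>2 - N - \<xi>\<^sup>2) - 4 * a ^ 4) * \<xi>\<^sup>2 + c\<^sup>2 * \<xi>\<^sup>2 * N)"
  have *: "((L + c\<^sup>2 + 2 * a * c) * E + (L + c\<^sup>2 - 2 * a * c) * D) * N = 2 * L * (D * E) + Z"
    unfolding D_def E_def Z_def by algebra
  have DE: "D \<noteq> 0" "E \<noteq> 0"
    using assms by (simp_all add: D_def E_def)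
  have "(L + c\<^sup>2 + 2 * a * c) / D + (L + c\<^sup>2 - 2 * a * c) / E =
      ((L + c\<^sup>2 + 2 * a * c) * E + (L + c\<^sup>2 - 2 * a * c) * D) / (D * E)"
    using DE by (simp add: add_frac_eq)
  also have "\<dots> = (2 * L * (D * E) + Z) / (N * (D * E))"
    unfolding *[symmetric] using assms(1) by simp
  also have "\<dots> = 2 * L / N + Z / (N * (D * E))"
    using DE assms(1) by (simp add: add_divide_distrib)
  finally show ?thesis
    unfolding D_def E_def Z_def .
qed

text \<open>
  The bonds from a point $(x, -z)$ to the ends $(c \<plusminus> a, y)$ of the horizontal segment
  do not increase when $x$ and $c$ are set to $0$. The critical coefficient of the identity is nonnegative because
  $(1 + a^2)(3a^2 - 9/10) - 4a^4 = (a^2 - 3/5)(3/2 - a^2)$.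
\<close>

lemma bonds_to_horizontal_pair_ge:
  fixes a c y x z :: real
  assumes A: "0.6 \<le> a\<^sup>2" "a\<^sup>2 \<le> 1" and near: "(x - c)\<^sup>2 + (z + y)\<^sup>2 \<le> 0.9" and zy: "z + y > 0"
  shows "2 * (1 + a\<^sup>2 + y\<^sup>2) / (a\<^sup>2 + (z + y)\<^sup>2) \<le>
    (1 + (c + a)\<^sup>2 + y\<^sup>2) / ((x - c - a)\<^sup>2 + (z + y)\<^sup>2) +
    (1 + (c - a)\<^sup>2 + y\<^sup>2) / ((x - c + a)\<^sup>2 + (z + y)\<^sup>2)"
proof -
  define \<xi> N L where "\<xi> = x - c" and "N = a\<^sup>2 + (z + y)\<^sup>2" and "L = 1 + a\<^sup>2 + y\<^sup>2"
  have D: "N + \<xi>\<^sup>2 - 2 * a * \<xi> = (x - c - a)\<^sup>2 + (z + y)\<^sup>2" "N + \<xi>\<^sup>2 + 2 * a * \<xi> = (x - c + a)\<^sup>2 + (z + y)\<^sup>2"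
    by (auto simp: N_def \<xi>_def power2_eq_square algebra_simps)
  have W: "L + c\<^sup>2 + 2 * a * c = 1 + (c + a)\<^sup>2 + y\<^sup>2" "L + c\<^sup>2 - 2 * a * c = 1 + (c - a)\<^sup>2 + y\<^sup>2"
    by (auto simp: L_def power2_eq_square algebra_simps)
  have N: "N > 0" and Dp: "(x - c - a)\<^sup>2 + (z + y)\<^sup>2 > 0" "(x - c + a)\<^sup>2 + (z + y)\<^sup>2 > 0"
    using zy by (auto simp: N_def add_nonneg_pos)
  (* Here 4 a^2 - N - \<xi>^2 = 3 a^2 - ((x - c)^2 + (z + y)^2) is at least 3 a^2 - 9/10. *)
  have "4 * a ^ 4 + (a\<^sup>2 - 0.6) * (1.5 - a\<^sup>2) = (1 + a\<^sup>2) * (3 * a\<^sup>2 - 0.9)"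
    by (simp add: power2_eq_square power4_eq_xxxx field_simps)
  moreover have "(a\<^sup>2 - 0.6) * (1.5 - a\<^sup>2) \<ge> 0"
    using A by simp
  moreover have "(1 + a\<^sup>2) * (3 * a\<^sup>2 - 0.9) \<le> L * (4 * a\<^sup>2 - N - \<xi>\<^sup>2)"
    using A near by (intro mult_mono) (auto simp: L_def N_def \<xi>_def)
  ultimately have "L * (4 * a\<^sup>2 - N - \<xi>\<^sup>2) - 4 * a ^ 4 \<ge> 0"
    by linarith
  then have "0 \<le> 2 * ((c * N + 2 * a\<^sup>2 * \<xi>)\<^sup>2 + (L * (4 * a\<^sup>2 - N - \<xi>\<^sup>2) - 4 * a ^ 4) * \<xi>\<^sup>2 + c\<^sup>2 * \<xi>\<^sup>2 * N) /
      (N * ((N + \<xi>\<^sup>2 - 2 * a * \<xi>) * (N + \<xi>\<^sup>2 + 2 * a * \<xi>)))"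
    unfolding D using N Dp by (intro divide_nonneg_nonneg mult_nonneg_nonneg add_nonneg_nonneg) auto
  moreover have "(L + c\<^sup>2 + 2 * a * c) / (N + \<xi>\<^sup>2 - 2 * a * \<xi>) + (L + c\<^sup>2 - 2 * a * c) / (N + \<xi>\<^sup>2 + 2 * a * \<xi>) =
    2 * L / N + 2 * ((c * N + 2 * a\<^sup>2 * \<xi>)\<^sup>2 + (L * (4 * a\<^sup>2 - N - \<xi>\<^sup>2) - 4 * a ^ 4) * \<xi>\<^sup>2 + c\<^sup>2 * \<xi>\<^sup>2 * N) /
      (N * ((N + \<xi>\<^sup>2 - 2 * a * \<xi>) * (N + \<xi>\<^sup>2 + 2 * a * \<xi>)))"
    by (rule two_quotients_identity) (unfold D, (rule less_imp_neq[symmetric], rule N Dp)+)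
  ultimately show ?thesis
    unfolding D W N_def[symmetric] L_def[symmetric] by linarith
qed

text \<open>
  The case $x_1 = x_3 = c = 0$, with the identity now applied to the vertical segment shifted by $w$, seen from
  the ends of the horizontal one at relative height $e = y - w$. Here the critical coefficient can be negative, but it is
  at least $-\<nu>$ on the slice $A_1 \<le> a^2 \<le> A_2$. The resulting deficit $\<mu> e^2$ is covered by
  $y^2$ and $w^2$: the factor $1 + a^2 + y^2$ contributes $2y^2$ (per half of the sum), and the rest is the
  amount $\frac{3}{10} y^2 + 2 K w^2$ that other terms of the energy will have to supply.
  The condition on $K$ says that $43/20$ and $K$ have parallel sum $\frac{43}{20} K / (\frac{43}{20} + K)$ at least $\<mu>$, which is
  what $\<mu> (y - w)^2 \<le> \frac{43}{20} y^2 + K w^2$ requires.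
\<close>

lemma cross_bonds_ge:
  fixes a b y w A1 A2 K \<mu> \<nu> :: real
  assumes A: "0.661 \<le> A1" "A1 \<le> a\<^sup>2" "a\<^sup>2 \<le> A2" and B: "0.4624 \<le> b\<^sup>2" "b\<^sup>2 \<le> 0.8236"
    and e: "(y - w)\<^sup>2 \<le> 0.0202" and y: "y\<^sup>2 \<le> 0.0008"
    and \<nu>: "1.4624 * A2 - 1.1438 \<le> \<nu>" "\<nu> \<ge> 0" "A2 \<le> 1"
    and \<mu>: "2 * (A2 + 1.0008) * \<nu> \<le> \<mu> * ((A1 + 0.4624) * ((A1 + 0.4624)\<^sup>2 - 0.007))" "\<mu> \<ge> 0"
    and K: "\<mu> * (K + 2.15) \<le> 2.15 * K" "K > 0"
    and pos: "b + w - y > 0" "b - w + y > 0"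
  shows "4 * (1 + a\<^sup>2) * (1 + b\<^sup>2) / (a\<^sup>2 + b\<^sup>2) \<le>
    2 * (1 + a\<^sup>2 + y\<^sup>2) * ((1 + (b + w)\<^sup>2) / (a\<^sup>2 + (b + w - y)\<^sup>2) + (1 + (b - w)\<^sup>2) / (a\<^sup>2 + (b - w + y)\<^sup>2))
    + 3 / 10 * y\<^sup>2 + 2 * K * w\<^sup>2"
proof -
  define e L S M where "e = y - w" and "L = 1 + b\<^sup>2" and "S = a\<^sup>2 + b\<^sup>2" and "M = 1 + a\<^sup>2 + y\<^sup>2"
  define D where "D = (S + e\<^sup>2 - 2 * b * e) * (S + e\<^sup>2 + 2 * b * e)"
  define Z where "Z = (w * S + 2 * b\<^sup>2 * e)\<^sup>2 + (L * (4 * b\<^sup>2 - S - e\<^sup>2) - 4 * b ^ 4) * e\<^sup>2 + w\<^sup>2 * e\<^sup>2 * S"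
  define R where "R = (1 + (b + w)\<^sup>2) / (a\<^sup>2 + (b + w - y)\<^sup>2) + (1 + (b - w)\<^sup>2) / (a\<^sup>2 + (b - w + y)\<^sup>2)"
  have De: "S + e\<^sup>2 - 2 * b * e = a\<^sup>2 + (b + w - y)\<^sup>2" "S + e\<^sup>2 + 2 * b * e = a\<^sup>2 + (b - w + y)\<^sup>2"
    by (auto simp: S_def e_def power2_eq_square algebra_simps)
  have We: "L + w\<^sup>2 + 2 * b * w = 1 + (b + w)\<^sup>2" "L + w\<^sup>2 - 2 * b * w = 1 + (b - w)\<^sup>2"
    by (auto simp: L_def power2_eq_square algebra_simps)
  have S: "S > 0" and Dp: "a\<^sup>2 + (b + w - y)\<^sup>2 > 0" "a\<^sup>2 + (b - w + y)\<^sup>2 > 0"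
    using A B pos by (auto simp: S_def add_nonneg_pos)
  have R: "R = 2 * L / S + 2 * Z / (S * D)"
    unfolding R_def D_def Z_def We[symmetric] De[symmetric]
    by (rule two_quotients_identity) (unfold De, (rule less_imp_neq[symmetric], rule S Dp)+)
  have "L * (4 * b\<^sup>2 - S - e\<^sup>2) - 4 * b ^ 4 = - (a\<^sup>2 * (1 + b\<^sup>2) - 3 * b\<^sup>2 + b\<^sup>2 * b\<^sup>2 + (1 + b\<^sup>2) * e\<^sup>2)"
    by (simp add: L_def S_def power2_eq_square power4_eq_xxxx algebra_simps)
  moreover have "\<alpha> * (1 + \<beta>) - 3 * \<beta> + \<beta> * \<beta> + (1 + \<beta>) * \<epsilon> \<le> \<nu>"
    if "\<alpha> \<le> A2" "0.4624 \<le> \<beta>" "\<beta> \<le> 0.8236" "\<epsilon> \<le> 0.0202" for \<alpha> \<beta> \<epsilon> :: real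
  proof -
    have "\<alpha> * (1 + \<beta>) + (1 + \<beta>) * \<epsilon> \<le> A2 * (1 + \<beta>) + (1 + \<beta>) * 0.0202"
      using that by (intro add_mono mult_right_mono mult_left_mono) auto
    (* The left-hand side decreases in \<beta>, so its maximum is at \<beta> = 0.4624 = 0.68^2. *)
    moreover have "0 \<le> (\<beta> - 0.4624) * (3 - A2 - \<beta> - 0.4624 - 0.0202)"
      using that \<nu>(3) by (intro mult_nonneg_nonneg) auto
    then have "A2 * (1 + \<beta>) + (1 + \<beta>) * 0.0202 - 3 * \<beta> + \<beta> * \<beta> \<le> 1.4624 * A2 - 1.1438"
      by (simp add: field_simps)
    ultimately show ?thesis
      using \<nu>(1) by linarith
  qed
  then have "a\<^sup>2 * (1 + b\<^sup>2) - 3 * b\<^sup>2 + b\<^sup>2 * b\<^sup>2 + (1 + b\<^sup>2) * e\<^sup>2 \<le> \<nu>"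
    using A B e unfolding e_def by blast
  ultimately have "- \<nu> * e\<^sup>2 \<le> (L * (4 * b\<^sup>2 - S - e\<^sup>2) - 4 * b ^ 4) * e\<^sup>2"
    by (intro mult_right_mono) auto
  moreover have "w\<^sup>2 * e\<^sup>2 * S \<ge> 0"
    using S by simp
  ultimately have Z: "- \<nu> * e\<^sup>2 \<le> Z"
    unfolding Z_def by (smt (verit) zero_le_power2)
  (* D is at least S^2 + 2 (a^2 - b^2) e^2, where b^2 - a^2 is at most 0.8236 - 0.661. *)
  have "(b\<^sup>2 - a\<^sup>2) * e\<^sup>2 \<le> 0.1626 * 0.0202"
  proof (rule mult_mono)
    show "b\<^sup>2 - a\<^sup>2 \<le> 0.1626"
      using A B by simp
    show "e\<^sup>2 \<le> 0.0202"
      using e by (simp add: e_def)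
  qed simp_all
  also have "\<dots> \<le> 0.007 / 2"
    by simp
  finally have "- 0.007 \<le> 2 * (a\<^sup>2 - b\<^sup>2) * e\<^sup>2"
    by (simp add: left_diff_distrib right_diff_distrib)
  moreover have "D = S\<^sup>2 + 2 * (a\<^sup>2 - b\<^sup>2) * e\<^sup>2 + (e\<^sup>2)\<^sup>2"
    by (simp add: D_def S_def power2_eq_square algebra_simps)
  ultimately have "S\<^sup>2 - 0.007 \<le> D"
    using zero_le_power2[of "e\<^sup>2"] by linarith
  moreover have S1: "A1 + 0.4624 \<le> S"
    using A B by (simp add: S_def)
  then have "(A1 + 0.4624)\<^sup>2 \<le> S\<^sup>2"
    using A by (intro power_mono) auto
  moreover have "(1.1234::real)\<^sup>2 \<le> (A1 + 0.4624)\<^sup>2"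
    using A by (intro power_mono) auto
  ultimately have SD: "(A1 + 0.4624) * ((A1 + 0.4624)\<^sup>2 - 0.007) \<le> S * D" and D: "D > 0"
    using S S1 A by (auto intro!: mult_mono simp: power2_eq_square)
  have M: "0 < M" "M \<le> A2 + 1.0008"
    using A y by (auto simp: M_def add_pos_nonneg)
  have "M * (2 * \<nu>) \<le> (A2 + 1.0008) * (2 * \<nu>)"
    using M \<nu> by (intro mult_right_mono) auto
  also have "\<dots> = 2 * (A2 + 1.0008) * \<nu>"
    by (simp only: mult.assoc mult.left_commute)
  also note \<mu>(1)
  also have "\<mu> * ((A1 + 0.4624) * ((A1 + 0.4624)\<^sup>2 - 0.007)) \<le> \<mu> * (S * D)"
    using SD \<mu>(2) by (rule mult_left_mono)
  finally have "M * (2 * \<nu>) * e\<^sup>2 \<le> \<mu> * (S * D) * e\<^sup>2"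
    by (intro mult_right_mono) auto
  moreover have "M * (- \<nu> * e\<^sup>2) \<le> M * Z"
    using M Z by (intro mult_left_mono) auto
  ultimately have "- \<mu> * e\<^sup>2 * (S * D) \<le> M * (2 * Z)"
    by (simp add: algebra_simps)
  then have MZ: "- \<mu> * e\<^sup>2 \<le> M * (2 * Z) / (S * D)"
    using S D by (simp add: pos_le_divide_eq)
  have "1 \<le> L / S"
    using S A \<nu> by (simp add: L_def S_def)
  then have "y\<^sup>2 * 1 \<le> y\<^sup>2 * (L / S)"
    by (intro mult_left_mono) auto
  moreover have "M * (2 * L / S) = (1 + a\<^sup>2) * (2 * L / S) + 2 * (y\<^sup>2 * (L / S))"
    unfolding M_def distrib_right by simp
  ultimately have "(1 + a\<^sup>2) * (2 * L / S) + 2 * y\<^sup>2 \<le> M * (2 * L / S)"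
    by linarith
  with MZ have *: "(1 + a\<^sup>2) * (2 * L / S) + 2 * y\<^sup>2 - \<mu> * e\<^sup>2 \<le> M * R"
    unfolding R by (simp add: distrib_left)
  have "(K + 2.15) * (\<mu> * (y - w)\<^sup>2) \<le> 2.15 * K * (y - w)\<^sup>2"
    using mult_right_mono[OF K(1), of "(y - w)\<^sup>2"] by (simp add: algebra_simps)
  also have "\<dots> = (K + 2.15) * (2.15 * y\<^sup>2 + K * w\<^sup>2) - (2.15 * y + K * w)\<^sup>2"
    by (simp add: power2_eq_square field_simps)
  also have "\<dots> \<le> (K + 2.15) * (2.15 * y\<^sup>2 + K * w\<^sup>2)"
    by simp
  finally have "\<mu> * e\<^sup>2 \<le> 43 / 20 * y\<^sup>2 + K * w\<^sup>2"
    using K(2) by (simp add: e_def mult_le_cancel_left_pos)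
  moreover have "4 * (1 + a\<^sup>2) * L / S = 2 * ((1 + a\<^sup>2) * (2 * L / S))"
    by simp
  ultimately have "4 * (1 + a\<^sup>2) * L / S \<le> 2 * (M * R) + 3 / 10 * y\<^sup>2 + 2 * (K * w\<^sup>2)"
    using * by argo
  then show ?thesis
    unfolding R_def[symmetric] M_def[symmetric] S_def[symmetric] L_def[symmetric] by (simp add: mult.assoc)
qed

text \<open>
  The price $2 K w^2$ of the previous lemma is affordable: after the change of base from the cross bonds to the
  weights $1 + b^2$ it is below the gain $8 w^2$ of the vertical pair. The
  deficit and the exchange rate both grow with $a^2$, so constants that fit one end of the range of
  $a^2$ fail at the other; three slices suffice.
\<close>

lemma cross_bonds_ge_exchanged:
  fixes a b y w h :: real
  assumes h: "1 \<le> h" "h \<le> 38/5" and A: "0.661 \<le> a\<^sup>2" "a\<^sup>2 \<le> 0.9467"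
    and B: "0.4624 \<le> b\<^sup>2" "b\<^sup>2 \<le> 0.8236"
    and e: "(y - w)\<^sup>2 \<le> 0.0202" and y: "y\<^sup>2 \<le> 0.0008"
    and pos: "b + w - y > 0" "b - w + y > 0"
  obtains (that') K where
    "2 * K * ((1 + a\<^sup>2) * (1 + b\<^sup>2) / (a\<^sup>2 + b\<^sup>2)) powr (h - 1) \<le> 799/100 * (1 + b\<^sup>2) powr (h - 1)"
    "4 * ((1 + a\<^sup>2) * (1 + b\<^sup>2) / (a\<^sup>2 + b\<^sup>2)) \<le>
      2 * (1 + a\<^sup>2 + y\<^sup>2) * ((1 + (b + w)\<^sup>2) / (a\<^sup>2 + (b + w - y)\<^sup>2) + (1 + (b - w)\<^sup>2) / (a\<^sup>2 + (b - w + y)\<^sup>2))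
      + 3 / 10 * y\<^sup>2 + 2 * K * w\<^sup>2"
proof -
  define F where "F = (1 + a\<^sup>2) * (1 + b\<^sup>2) / (a\<^sup>2 + b\<^sup>2)"
  have case_bound: thesis
    if "0.661 \<le> A1" "A1 \<le> a\<^sup>2" "a\<^sup>2 \<le> A2" "A2 \<le> 1"
      "1.4624 * A2 - 1.1438 \<le> \<nu>" "\<nu> \<ge> 0"
      "2 * (A2 + 1.0008) * \<nu> \<le> \<mu> * ((A1 + 0.4624) * ((A1 + 0.4624)\<^sup>2 - 0.007))" "\<mu> \<ge> 0"
      "\<mu> * (K + 2.15) \<le> 2.15 * K" "K > 0"
      "0 < r" "r \<le> 1" "r * (1 + A1) \<le> A1 + 0.4624" "0 \<le> k" "k ^ 5 \<le> r ^ 33" "2 * K \<le> 799/100 * k"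
    for A1 A2 \<nu> \<mu> K r k :: real
  proof (rule that')
    (* The ratio of the bases is (a^2 + b^2) / (1 + a^2), which increases in both a^2 and b^2. *)
    have "r * (1 + a\<^sup>2) \<le> a\<^sup>2 + b\<^sup>2"
    proof -
      have "0 \<le> (1 - r) * (a\<^sup>2 - A1)"
        using that by simp
      then show ?thesis
        using that(13) B(1) by (simp add: algebra_simps)
    qed
    then have "r * (1 + a\<^sup>2) * (1 + b\<^sup>2) \<le> (a\<^sup>2 + b\<^sup>2) * (1 + b\<^sup>2)"
      by (intro mult_right_mono) auto
    moreover have "a\<^sup>2 + b\<^sup>2 > 0"
      by (rule add_pos_nonneg[OF less_le_trans[OF _ A(1)]]) simp_all
    ultimately have "r * F \<le> 1 + b\<^sup>2"
      unfolding F_def by (simp add: divide_le_eq mult.commute mult.left_commute)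
    then have "k * F powr (h - 1) \<le> (1 + b\<^sup>2) powr (h - 1)"
      using that h by (intro powr_exchange_rate[of _ r]) (auto simp: F_def)
    moreover have "2 * K * F powr (h - 1) \<le> 799/100 * k * F powr (h - 1)"
      using that by (intro mult_right_mono) auto
    ultimately show "2 * K * ((1 + a\<^sup>2) * (1 + b\<^sup>2) / (a\<^sup>2 + b\<^sup>2)) powr (h - 1) \<le> 799/100 * (1 + b\<^sup>2) powr (h - 1)"
      unfolding F_def[symmetric] by linarith
    show "4 * ((1 + a\<^sup>2) * (1 + b\<^sup>2) / (a\<^sup>2 + b\<^sup>2)) \<le>
      2 * (1 + a\<^sup>2 + y\<^sup>2) * ((1 + (b + w)\<^sup>2) / (a\<^sup>2 + (b + w - y)\<^sup>2) + (1 + (b - w)\<^sup>2) / (a\<^sup>2 + (b - w + y)\<^sup>2))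
      + 3 / 10 * y\<^sup>2 + 2 * K * w\<^sup>2"
      using cross_bonds_ge[OF that(1-3) B e y that(5,6,4,7-10) pos] by (simp only: times_divide_eq_right mult.assoc)
  qed
  (* In each slice \<nu> is its linear lower bound at the upper end, rounded up; \<mu> and K are then
     chosen in turn, and r is the ratio of the bases at the lower end, rounded down. *)
  consider "a\<^sup>2 \<le> 0.83" | "0.83 \<le> a\<^sup>2" "a\<^sup>2 \<le> 0.905" | "0.905 \<le> a\<^sup>2"
    by linarith
  then show thesis
  proof cases
    case 1
    show ?thesis
      by (rule case_bound[of "0.661" "0.83" "0.07" "0.19" "0.26" "0.676" "0.066"]) (use 1 A in \<open>simp_all add: power_divide divide_simps\<close>)
  next
    case 2
    show ?thesis
      by (rule case_bound[of "0.83" "0.905" "0.18" "0.32" "0.39" "0.706" "0.098"]) (use 2 A in \<open>simp_all add: power_divide divide_simps\<close>)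
  next
    case 3
    show ?thesis
      by (rule case_bound[of "0.905" "0.9467" "0.2407" "0.3682" "0.445" "0.7177" "0.1115"]) (use 3 A in \<open>simp_all add: power_divide divide_simps\<close>)
  qed
qed

section \<open>The vertical pair and the north pole\<close>

text \<open>
  Moving the points of the vertical pair apart horizontally lowers their mutual bond, while raising their bonds with
  the north pole. The second effect wins, because $(1 + b^2)^2 / (4 b^2) \<le> 1 + b^2$: the mutual bond has the
  smaller base, so that only the first powers have to be compared. The sixth-power tangent
  supplies, in addition to $2 w^2$, a gain of about $6 w^2$ from the imbalance $\<tau>$ of the two weights.
\<close>

lemma vertical_pair_ge:
  fixes b w x1 x3 h :: real
  assumes h: "h \<ge> 6" and b: "0.462 \<le> b\<^sup>2" "b\<^sup>2 \<le> 0.95" and x: "((x1 - x3) / 2)\<^sup>2 \<le> 0.0034"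
  shows "2 * (1 + b\<^sup>2) powr h + ((1 + b\<^sup>2)\<^sup>2 / (4 * b\<^sup>2)) powr h
      + h * (1 + b\<^sup>2) powr (h - 1) * (8 * w\<^sup>2 + (x1\<^sup>2 + x3\<^sup>2) / 2) \<le>
    (1 + x1\<^sup>2 + (w - b)\<^sup>2) powr h + (1 + x3\<^sup>2 + (w + b)\<^sup>2) powr h
      + ((1 + x1\<^sup>2 + (w - b)\<^sup>2) * (1 + x3\<^sup>2 + (w + b)\<^sup>2) / ((x1 - x3)\<^sup>2 + 4 * b\<^sup>2)) powr h"
proof -
  define m n G where "m = (x1 + x3) / 2" and "n = (x1 - x3) / 2" and "G = 1 + b\<^sup>2"
  define q \<tau> where "q = m\<^sup>2 + n\<^sup>2 + w\<^sup>2" and "\<tau> = 2 * (w * b - m * n)"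
  define f g where "f = 1 + x1\<^sup>2 + (w - b)\<^sup>2" and "g = 1 + x3\<^sup>2 + (w + b)\<^sup>2"
  have fg: "f = G + q - \<tau>" "g = G + q + \<tau>"
    by (simp_all add: f_def g_def G_def q_def \<tau>_def m_def n_def power2_eq_square field_simps)
  have xs: "x1 = m + n" "x3 = m - n"
    by (simp_all add: m_def n_def field_simps)
  have G: "G > 0" "G \<ge> 1.46" "G \<le> 1.95" and q: "q \<ge> 0" and n: "n\<^sup>2 \<le> 0.0034"
    using b x by (simp_all add: G_def q_def n_def)
  have B: "b\<^sup>2 > 0"
    by (rule less_le_trans[OF _ b(1)]) simp
  have pos: "f > 0" "g > 0"
    by (simp_all add: f_def g_def add_pos_nonneg)

  have u: "2 * G ^ 6 + 6 * G ^ 5 * (2 * q + 5 * \<tau>\<^sup>2 / G) \<le> f ^ 6 + g ^ 6"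
  proof -
    have "f ^ 6 + g ^ 6 = 2 * (G + q) ^ 6 + 30 * (G + q) ^ 4 * \<tau>\<^sup>2 + (30 * (G + q)\<^sup>2 * \<tau> ^ 4 + 2 * \<tau> ^ 6)"
      unfolding fg by algebra
    moreover have "30 * (G + q)\<^sup>2 * \<tau> ^ 4 + 2 * \<tau> ^ 6 \<ge> 0"
      by simp
    moreover have "(G + q) ^ 4 * \<tau>\<^sup>2 \<ge> G ^ 4 * \<tau>\<^sup>2"
      using G q by (intro mult_right_mono power_mono) auto
    moreover have "(G + q) ^ 6 \<ge> G ^ 6 + 6 * G ^ 5 * q"
    proof -
      have "(G + q) ^ 6 = G ^ 6 + 6 * G ^ 5 * q +
          (15 * G ^ 4 * q\<^sup>2 + 20 * G ^ 3 * q ^ 3 + 15 * G\<^sup>2 * q ^ 4 + 6 * G * q ^ 5 + q ^ 6)"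
        by algebra
      then show ?thesis
        using G q by simp
    qed
    moreover have "6 * G ^ 5 * (2 * q + 5 * \<tau>\<^sup>2 / G) = 12 * G ^ 5 * q + 30 * G ^ 4 * \<tau>\<^sup>2"
      using G by (simp add: field_simps power_eq_if)
    ultimately show ?thesis
      by linarith
  qed

  define d where "d = f * g / ((x1 - x3)\<^sup>2 + 4 * b\<^sup>2)"
  have den: "(x1 - x3)\<^sup>2 + 4 * b\<^sup>2 = 4 * (b\<^sup>2 + n\<^sup>2)"
    by (simp add: n_def power_divide)
  have bn: "b\<^sup>2 + n\<^sup>2 > 0"
    using B by (simp add: add_pos_nonneg)
  have dG: "d \<ge> G\<^sup>2 / (4 * b\<^sup>2) - n\<^sup>2"
  proof -
    have "(G\<^sup>2 / (4 * b\<^sup>2) - n\<^sup>2) * (4 * (b\<^sup>2 + n\<^sup>2)) = G\<^sup>2 + n\<^sup>2 * (G\<^sup>2 / b\<^sup>2) - 4 * n\<^sup>2 * (b\<^sup>2 + n\<^sup>2)"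
      using B by (simp add: field_simps)
    also have "n\<^sup>2 * (G\<^sup>2 / b\<^sup>2) \<le> n\<^sup>2 * (2 * G + 4 * b\<^sup>2)"
    proof (rule mult_left_mono)
      have "(0.462::real) * 0.462 \<le> b\<^sup>2 * b\<^sup>2"
        using b by (intro mult_mono) auto
      then have "G\<^sup>2 \<le> (2 * G + 4 * b\<^sup>2) * b\<^sup>2"
        by (simp add: G_def power2_eq_square algebra_simps)
      then show "G\<^sup>2 / b\<^sup>2 \<le> 2 * G + 4 * b\<^sup>2"
        using B by (simp add: divide_le_eq)
    qed simp
    also have "G\<^sup>2 + n\<^sup>2 * (2 * G + 4 * b\<^sup>2) - 4 * n\<^sup>2 * (b\<^sup>2 + n\<^sup>2) \<le> G\<^sup>2 + 2 * G * n\<^sup>2"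
      by (simp add: algebra_simps)
    also have "\<dots> \<le> (G + q)\<^sup>2 - \<tau>\<^sup>2"
    proof -
      have "(m\<^sup>2 + w\<^sup>2) * (4 * (b\<^sup>2 + n\<^sup>2)) \<le> (m\<^sup>2 + w\<^sup>2) * (2 * G)"
        using b n by (intro mult_left_mono) (auto simp: G_def)
      moreover have "(m\<^sup>2 + w\<^sup>2) * (4 * (b\<^sup>2 + n\<^sup>2)) - \<tau>\<^sup>2 = 4 * (w * n + m * b)\<^sup>2"
        unfolding \<tau>_def by algebra
      moreover have "(G + q)\<^sup>2 = G\<^sup>2 + 2 * G * n\<^sup>2 + (m\<^sup>2 + w\<^sup>2) * (2 * G) + q\<^sup>2"
        unfolding q_def by algebra
      ultimately show ?thesis
        by (smt (verit) zero_le_power2)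
    qed
    also have "(G + q)\<^sup>2 - \<tau>\<^sup>2 = f * g"
      unfolding fg by algebra
    finally show ?thesis
      using bn unfolding d_def den by (simp add: pos_le_divide_eq)
  qed
  have G4: "0 < G\<^sup>2 / (4 * b\<^sup>2)" "G\<^sup>2 / (4 * b\<^sup>2) \<le> G"
  proof -
    have "G * G \<le> G * (4 * b\<^sup>2)"
      using G b by (intro mult_left_mono) (auto simp: G_def)
    then show "G\<^sup>2 / (4 * b\<^sup>2) \<le> G"
      using B by (simp add: divide_le_eq power2_eq_square)
  qed (use G B in simp)
  have "d > 0"
    using pos bn unfolding d_def den by simp
  (* The loss in the mutual bond is charged at the larger base G. *)
  have "- (h * G powr (h - 1) * n\<^sup>2) \<le> - (h * (G\<^sup>2 / (4 * b\<^sup>2)) powr (h - 1) * n\<^sup>2)"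
    using G4 h by (auto intro!: mult_right_mono mult_left_mono powr_mono2)
  also have "\<dots> \<le> h * (G\<^sup>2 / (4 * b\<^sup>2)) powr (h - 1) * (d - G\<^sup>2 / (4 * b\<^sup>2))"
    using mult_left_mono[of "- n\<^sup>2" "d - G\<^sup>2 / (4 * b\<^sup>2)" "h * (G\<^sup>2 / (4 * b\<^sup>2)) powr (h - 1)"] dG h by simp
  finally have d: "(G\<^sup>2 / (4 * b\<^sup>2)) powr h - h * G powr (h - 1) * n\<^sup>2 \<le> d powr h"
    using powr_above_tangent[OF \<open>d > 0\<close> G4(1), of h] h by linarith

  have "8 * w\<^sup>2 + (x1\<^sup>2 + x3\<^sup>2) / 2 \<le> 2 * q + 5 * \<tau>\<^sup>2 / G - n\<^sup>2"
  proof -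
    (* m * n is of second order; completing the square with weight 1/20 separates it from w * b. *)
    have "19/20 * (w * b)\<^sup>2 - 19 * (m * n)\<^sup>2 \<le> (w * b - m * n)\<^sup>2"
      using zero_le_power2[of "w * b - 20 * (m * n)"] by (simp add: power2_eq_square field_simps)
    moreover have "\<tau>\<^sup>2 = 4 * (w * b - m * n)\<^sup>2"
      unfolding \<tau>_def by algebra
    ultimately have "19 * (w\<^sup>2 * b\<^sup>2) - 380 * (m\<^sup>2 * n\<^sup>2) \<le> 5 * \<tau>\<^sup>2"
      by (simp add: power_mult_distrib)
    then have "(19 * (w\<^sup>2 * b\<^sup>2) - 380 * (m\<^sup>2 * n\<^sup>2)) / G \<le> 5 * \<tau>\<^sup>2 / G"
      using G by (intro divide_right_mono) auto
    moreover have "6 * w\<^sup>2 - m\<^sup>2 \<le> (19 * (w\<^sup>2 * b\<^sup>2) - 380 * (m\<^sup>2 * n\<^sup>2)) / G"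
    proof -
      have "w\<^sup>2 * (6 * G) \<le> w\<^sup>2 * (19 * b\<^sup>2)"
        using b by (intro mult_left_mono) (auto simp: G_def)
      moreover have "m\<^sup>2 * (380 * n\<^sup>2) \<le> m\<^sup>2 * G"
        using n G by (intro mult_left_mono) auto
      ultimately show ?thesis
        unfolding pos_le_divide_eq[OF G(1)] by (simp add: algebra_simps)
    qed
    ultimately have "6 * w\<^sup>2 - m\<^sup>2 \<le> 5 * \<tau>\<^sup>2 / G"
      by simp
    moreover have "x1\<^sup>2 + x3\<^sup>2 = 2 * m\<^sup>2 + 2 * n\<^sup>2"
      unfolding xs by algebra
    ultimately show ?thesis
      unfolding q_def by (simp add: field_simps)
  qed
  then have "h * G powr (h - 1) * (8 * w\<^sup>2 + (x1\<^sup>2 + x3\<^sup>2) / 2) \<le> h * G powr (h - 1) * (2 * q + 5 * \<tau>\<^sup>2 / G - n\<^sup>2)"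
    using h by (intro mult_left_mono) auto
  also have "\<dots> = h * G powr (h - 1) * (2 * q + 5 * \<tau>\<^sup>2 / G) - h * G powr (h - 1) * n\<^sup>2"
    by (simp add: algebra_simps)
  finally show ?thesis
    using powr_sum_above_sixth_power_tangent[OF pos G(1) h u] d
    unfolding d_def G_def[symmetric] f_def[symmetric] g_def[symmetric] by linarith
qed

section \<open>The planar potential and its gap\<close>

definition weight :: "real^2 \<Rightarrow> real" where
  "weight p = 1 + (p $ 1)\<^sup>2 + (p $ 2)\<^sup>2"

definition bond :: "real^2 \<Rightarrow> real^2 \<Rightarrow> real" where
  "bond p q = weight p * weight q / ((p $ 1 - q $ 1)\<^sup>2 + (p $ 2 - q $ 2)\<^sup>2)"

text \<open>
  The Riesz energy of the configuration, up to the factor $4^{-h}$ with $h = s/2$: a chord between two lifted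
  points has squared length $4 / \mathit{bond}$, and a chord to the north pole $4 / \mathit{weight}$.
\<close>

fun potential :: "real \<Rightarrow> quad \<Rightarrow> real" where
  "potential h (p0, p1, p2, p3) =
     weight p0 powr h + weight p1 powr h + weight p2 powr h + weight p3 powr h
     + bond p0 p2 powr h + bond p1 p3 powr h
     + bond p0 p1 powr h + bond p0 p3 powr h + bond p2 p1 powr h + bond p2 p3 powr h"

lemma weight_pos: "weight p > 0"
  by (simp add: weight_def add_pos_nonneg)

lemma bond_commute: "bond p q = bond q p"
  by (simp add: bond_def mult.commute power2_commute)

lemma potential_rhombus:
  assumes "a > 0" "b > 0"
  shows "potential h (vector [a, 0], vector [0, - b], - vector [a, 0], - vector [0, - b]) =
    2 * (1 + a\<^sup>2) powr h + 2 * (1 + b\<^sup>2) powr h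
    + ((1 + a\<^sup>2)\<^sup>2 / (4 * a\<^sup>2)) powr h + ((1 + b\<^sup>2)\<^sup>2 / (4 * b\<^sup>2)) powr h
    + 4 * ((1 + a\<^sup>2) * (1 + b\<^sup>2) / (a\<^sup>2 + b\<^sup>2)) powr h"
  by (simp add: weight_def bond_def power2_eq_square)

text \<open>
  The heart of the argument: in coordinates adapted to the symmetrization the potential exceeds that of the
  rhombus $(\<plusminus> a, 0)$, $(0, \<plusminus> b)$ by a positive multiple of $c^2 + y^2$ and $w^2 + x_1^2 + x_3^2$. The ten terms
  fall into the horizontal pair, the vertical pair and the cross bonds; the deficit of the
  cross bonds in $y^2$ and $w^2$ is paid by the gains of the two pairs.
\<close>

lemma potential_gap:
  fixes a b c y w x1 x3 h :: real
  assumes h: "6 \<le> h" "h \<le> 38/5" and A: "0.661 \<le> a\<^sup>2" "a\<^sup>2 \<le> 0.9467"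
    and z: "b - w \<in> {0.68..0.9075}" "b + w \<in> {0.68..0.9075}"
    and y: "\<bar>y\<bar> \<le> 0.0282" and c: "\<bar>c\<bar> \<le> 0.0966" and x: "\<bar>x1\<bar> \<le> 0.0576" "\<bar>x3\<bar> \<le> 0.0576"
  shows "2 * (1 + a\<^sup>2) powr h + 2 * (1 + b\<^sup>2) powr h
      + ((1 + a\<^sup>2)\<^sup>2 / (4 * a\<^sup>2)) powr h + ((1 + b\<^sup>2)\<^sup>2 / (4 * b\<^sup>2)) powr h
      + 4 * ((1 + a\<^sup>2) * (1 + b\<^sup>2) / (a\<^sup>2 + b\<^sup>2)) powr h
      + h * ((1 + a\<^sup>2) powr (h - 1) * ((c\<^sup>2 + y\<^sup>2) / 5) + (1 + b\<^sup>2) powr (h - 1) * ((w\<^sup>2 + x1\<^sup>2 + x3\<^sup>2) / 100))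
    \<le> potential h (vector [c + a, y], vector [x1, w - b], vector [c - a, y], vector [x3, w + b])"
proof -
  have b: "0.68 \<le> b" "b \<le> 0.9075" and w: "\<bar>w\<bar> \<le> 0.11375"
    using z by auto
  have B: "0.4624 \<le> b\<^sup>2" "b\<^sup>2 \<le> 0.8236"
    using power_mono[of "0.68" b 2] power_mono[of b "0.9075" 2] b by (simp_all add: power2_eq_square)
  have y2: "y\<^sup>2 \<le> 0.0008"
    using square_le_of_abs_le[OF y] by (simp add: power2_eq_square)
  have e2: "(y - w)\<^sup>2 \<le> 0.0202"
  proof -
    have "\<bar>y - w\<bar> \<le> 0.14195"
      using y w unfolding abs_le_iff by simp_all
    from square_le_of_abs_le[OF this] show ?thesis
      by (simp add: power2_eq_square)
  qed
  have n2: "((x1 - x3) / 2)\<^sup>2 \<le> 0.0034"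
  proof -
    have "\<bar>x1 - x3\<bar> \<le> 0.1152"
      using x unfolding abs_le_iff by simp_all
    from square_le_of_abs_le[OF this] show ?thesis
      by (simp add: power_divide power2_eq_square)
  qed
  have near: "(x - c)\<^sup>2 + (u + v)\<^sup>2 \<le> 0.9" if "\<bar>x\<bar> \<le> 0.0576" "\<bar>u\<bar> \<le> 0.9075" "\<bar>v\<bar> \<le> 0.0282" for x u v
  proof -
    have "\<bar>x - c\<bar> \<le> 0.1542" "\<bar>u + v\<bar> \<le> 0.9357"
      using that c unfolding abs_le_iff by simp_all
    from this[THEN square_le_of_abs_le] show ?thesis
      by (simp add: power2_eq_square)
  qed

  define F where "F = (1 + a\<^sup>2) * (1 + b\<^sup>2) / (a\<^sup>2 + b\<^sup>2)"
  have a2: "a\<^sup>2 > 0" and b2: "b\<^sup>2 > 0"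
    by (rule less_le_trans[OF _ A(1)] less_le_trans[OF _ B(1)], simp)+
  have F: "F > 0"
    using a2 b2 by (simp add: F_def add_pos_pos divide_pos_pos)
  have h1: "1 \<le> h"
    using h by simp
  have zy: "b - w + y > 0" "b + w - y > 0"
    using z y by auto
  obtain K where K: "2 * K * F powr (h - 1) \<le> 799/100 * (1 + b\<^sup>2) powr (h - 1)"
    "4 * F \<le> 2 * (1 + a\<^sup>2 + y\<^sup>2) * ((1 + (b + w)\<^sup>2) / (a\<^sup>2 + (b + w - y)\<^sup>2) + (1 + (b - w)\<^sup>2) / (a\<^sup>2 + (b - w + y)\<^sup>2))
      + 3 / 10 * y\<^sup>2 + 2 * K * w\<^sup>2"
    by (rule cross_bonds_ge_exchanged[OF h1 h(2) A B e2 y2 zy(2,1), folded F_def])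

  define f0 f1 f2 f3 where "f0 = 1 + (c + a)\<^sup>2 + y\<^sup>2" and "f1 = 1 + x1\<^sup>2 + (w - b)\<^sup>2"
    and "f2 = 1 + (c - a)\<^sup>2 + y\<^sup>2" and "f3 = 1 + x3\<^sup>2 + (w + b)\<^sup>2"
  have fpos: "f0 > 0" "f1 > 0" "f2 > 0" "f3 > 0"
    by (simp_all add: f0_def f1_def f2_def f3_def add_pos_nonneg)
  define d01 d21 d03 d23 where "d01 = (x1 - c - a)\<^sup>2 + (b - w + y)\<^sup>2" and "d21 = (x1 - c + a)\<^sup>2 + (b - w + y)\<^sup>2"
    and "d03 = (x3 - c - a)\<^sup>2 + (b + w - y)\<^sup>2" and "d23 = (x3 - c + a)\<^sup>2 + (b + w - y)\<^sup>2"
  have dpos: "d01 > 0" "d21 > 0" "d03 > 0" "d23 > 0"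
    using zy by (simp_all add: d01_def d21_def d03_def d23_def add_nonneg_pos)
  have expand: "potential h (vector [c + a, y], vector [x1, w - b], vector [c - a, y], vector [x3, w + b]) =
      f0 powr h + f1 powr h + f2 powr h + f3 powr h
      + (f0 * f2 / (4 * a\<^sup>2)) powr h + (f1 * f3 / ((x1 - x3)\<^sup>2 + 4 * b\<^sup>2)) powr h
      + (f0 * f1 / d01) powr h + (f0 * f3 / d03) powr h + (f2 * f1 / d21) powr h + (f2 * f3 / d23) powr h"
  proof -
    have "(c + a - (c - a))\<^sup>2 + (y - y)\<^sup>2 = 4 * a\<^sup>2" "(w - b - (w + b))\<^sup>2 = 4 * b\<^sup>2"
      "(c + a - x1)\<^sup>2 + (y - (w - b))\<^sup>2 = d01" "(c + a - x3)\<^sup>2 + (y - (w + b))\<^sup>2 = d03"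
      "(c - a - x1)\<^sup>2 + (y - (w - b))\<^sup>2 = d21" "(c - a - x3)\<^sup>2 + (y - (w + b))\<^sup>2 = d23"
      by (simp_all add: d01_def d03_def d21_def d23_def power2_eq_square algebra_simps)
    then show ?thesis
      by (simp only: potential.simps bond_def weight_def vector_2 f0_def f1_def f2_def f3_def)
  qed

  have row: "2 * (1 + a\<^sup>2) powr h + h * (1 + a\<^sup>2) powr (h - 1) * (2 * (c\<^sup>2 + y\<^sup>2)) \<le> f0 powr h + f2 powr h"
  proof -
    have "f0 + f2 - 2 * (1 + a\<^sup>2) = 2 * (c\<^sup>2 + y\<^sup>2)"
      unfolding f0_def f2_def by algebra
    then show ?thesis
      using powr_sum_above_two_tangents[of f0 f2 "1 + a\<^sup>2" h] fpos h by (simp add: add_pos_nonneg)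
  qed
  have row_bond: "((1 + a\<^sup>2)\<^sup>2 / (4 * a\<^sup>2)) powr h \<le> (f0 * f2 / (4 * a\<^sup>2)) powr h"
  proof (intro powr_mono2 divide_right_mono)
    have "f0 * f2 = (1 + a\<^sup>2)\<^sup>2 + (2 * (1 - a\<^sup>2) * c\<^sup>2 + 2 * (1 + a\<^sup>2) * y\<^sup>2 + (c\<^sup>2 + y\<^sup>2)\<^sup>2)"
      unfolding f0_def f2_def by algebra
    moreover have "0 \<le> 1 - a\<^sup>2"
      using A by simp
    ultimately show "(1 + a\<^sup>2)\<^sup>2 \<le> f0 * f2"
      by simp
  qed (use h in auto)
  have column: "2 * (1 + b\<^sup>2) powr h + ((1 + b\<^sup>2)\<^sup>2 / (4 * b\<^sup>2)) powr h
      + h * (1 + b\<^sup>2) powr (h - 1) * (8 * w\<^sup>2 + (x1\<^sup>2 + x3\<^sup>2) / 2)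
      \<le> f1 powr h + f3 powr h + (f1 * f3 / ((x1 - x3)\<^sup>2 + 4 * b\<^sup>2)) powr h"
    unfolding f1_def f3_def using B by (intro vertical_pair_ge h n2) auto

  have cross: "4 * F powr h - h * F powr (h - 1) * (3 / 10 * y\<^sup>2 + 2 * K * w\<^sup>2)
      \<le> (f0 * f1 / d01) powr h + (f0 * f3 / d03) powr h + (f2 * f1 / d21) powr h + (f2 * f3 / d23) powr h"
  proof (rule sum4_powr_above_tangent)
    define L where "L = 2 * (1 + a\<^sup>2 + y\<^sup>2)"
    have L: "L \<ge> 0"
      by (simp add: L_def)
    have "L / (a\<^sup>2 + (b - w + y)\<^sup>2) \<le> f0 / d01 + f2 / d21"
      unfolding L_def f0_def f2_def d01_def d21_def
      using A x y z zy by (intro bonds_to_horizontal_pair_ge near) auto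
    then have 1: "(1 + (b - w)\<^sup>2) * (L / (a\<^sup>2 + (b - w + y)\<^sup>2)) \<le> f1 * (f0 / d01 + f2 / d21)"
      using L fpos by (intro mult_mono) (auto simp: f1_def power2_commute)
    have "L / (a\<^sup>2 + (b + w - y)\<^sup>2) \<le> f0 / d03 + f2 / d23"
      unfolding L_def f0_def f2_def d03_def d23_def
      using bonds_to_horizontal_pair_ge[of a x3 c "b + w" "- y"] near[of x3 "b + w" "- y"] A x y z zy by simp
    then have 2: "(1 + (b + w)\<^sup>2) * (L / (a\<^sup>2 + (b + w - y)\<^sup>2)) \<le> f3 * (f0 / d03 + f2 / d23)"
      using L fpos by (intro mult_mono) (auto simp: f3_def add.commute)
    have "L * ((1 + (b + w)\<^sup>2) / (a\<^sup>2 + (b + w - y)\<^sup>2) + (1 + (b - w)\<^sup>2) / (a\<^sup>2 + (b - w + y)\<^sup>2))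
        \<le> f1 * (f0 / d01 + f2 / d21) + f3 * (f0 / d03 + f2 / d23)"
      using add_mono[OF 1 2] by (simp add: distrib_left mult.commute add.commute)
    also have "\<dots> = f0 * f1 / d01 + f0 * f3 / d03 + f2 * f1 / d21 + f2 * f3 / d23"
      by (simp add: distrib_left mult.commute)
    finally show "4 * F - (3 / 10 * y\<^sup>2 + 2 * K * w\<^sup>2) \<le> f0 * f1 / d01 + f0 * f3 / d03 + f2 * f1 / d21 + f2 * f3 / d23"
      using K(2) unfolding L_def[symmetric] by linarith
  qed (use fpos dpos F h in auto)

  (* 0.768 bounds (a^2 + b^2) / (1 + b^2) at the lower ends 0.661 and 0.4624. *)
  have "17 / 100 * F powr (h - 1) \<le> (1 + a\<^sup>2) powr (h - 1)"
  proof (rule powr_exchange_rate[where r = "0.768"])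
    have "0.768 * (1 + b\<^sup>2) \<le> a\<^sup>2 + b\<^sup>2"
      using A B by simp
    then have "0.768 * (1 + b\<^sup>2) * (1 + a\<^sup>2) \<le> (a\<^sup>2 + b\<^sup>2) * (1 + a\<^sup>2)"
      by (intro mult_right_mono) auto
    moreover have "a\<^sup>2 + b\<^sup>2 > 0"
      using a2 b2 by (rule add_pos_pos)
    ultimately show "0.768 * F \<le> 1 + a\<^sup>2"
      unfolding F_def times_divide_eq_right by (subst pos_divide_le_eq) (simp_all only: mult_ac)
  qed (use F h in \<open>simp_all add: power_divide divide_simps\<close>)
  then have "F powr (h - 1) \<le> 6 * (1 + a\<^sup>2) powr (h - 1)"
    using powr_ge_zero[of "1 + a\<^sup>2" "h - 1"] by linarith
  define P G1 G2 where "P = F powr (h - 1)" and "G1 = (1 + a\<^sup>2) powr (h - 1)" and "G2 = (1 + b\<^sup>2) powr (h - 1)"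
  have "P * y\<^sup>2 \<le> 6 * G1 * y\<^sup>2"
    using \<open>F powr (h - 1) \<le> 6 * (1 + a\<^sup>2) powr (h - 1)\<close> unfolding P_def G1_def by (rule mult_right_mono) simp
  moreover have "2 * K * P * w\<^sup>2 \<le> 799 / 100 * G2 * w\<^sup>2"
    using K(1) unfolding P_def G2_def by (rule mult_right_mono) simp
  ultimately have "0 \<le> 18 / 10 * (G1 * c\<^sup>2) + 49 / 100 * (G2 * (x1\<^sup>2 + x3\<^sup>2))
      + 3 / 10 * (6 * G1 * y\<^sup>2 - P * y\<^sup>2) + (799 / 100 * G2 * w\<^sup>2 - 2 * K * P * w\<^sup>2)"
    by (intro add_nonneg_nonneg mult_nonneg_nonneg) (simp_all add: G1_def G2_def)
  define t u v g where "t = 3 / 10 * y\<^sup>2 + 2 * K * w\<^sup>2" and "u = 2 * (c\<^sup>2 + y\<^sup>2)" and "v = 8 * w\<^sup>2 + (x1\<^sup>2 + x3\<^sup>2) / 2"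
    and "g = G1 * ((c\<^sup>2 + y\<^sup>2) / 5) + G2 * ((w\<^sup>2 + x1\<^sup>2 + x3\<^sup>2) / 100)"
  note \<open>0 \<le> 18 / 10 * (G1 * c\<^sup>2) + _ + _ + _\<close>
  also have "18 / 10 * (G1 * c\<^sup>2) + 49 / 100 * (G2 * (x1\<^sup>2 + x3\<^sup>2))
      + 3 / 10 * (6 * G1 * y\<^sup>2 - P * y\<^sup>2) + (799 / 100 * G2 * w\<^sup>2 - 2 * K * P * w\<^sup>2)
    = G1 * u + G2 * v - g - P * t"
    by (simp add: t_def u_def v_def g_def field_simps)
  finally have "h * (g + P * t) \<le> h * (G1 * u + G2 * v)"
    using h by (intro mult_left_mono) auto
  then have "h * g + h * P * t \<le> h * G1 * u + h * G2 * v"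
    by (simp add: distrib_left mult.assoc)
  then show ?thesis
    using row row_bond column cross
    unfolding expand F_def[symmetric] P_def[symmetric] G1_def[symmetric] G2_def[symmetric]
      t_def[symmetric] u_def[symmetric] v_def[symmetric] g_def[symmetric]
    by linarith
qed

section \<open>Energy in stereographic coordinates\<close>

lemma weight_norm: "weight p = 1 + (norm p)\<^sup>2"
  by (simp add: weight_def norm_vec_def L2_set_def sum_2)

lemma bond_norm: "bond p q = weight p * weight q / (norm (p - q))\<^sup>2"
  by (simp add: bond_def norm_vec_def L2_set_def sum_2)

lemma bond_pos: "p \<noteq> q \<Longrightarrow> bond p q > 0"
  by (simp add: bond_norm weight_pos)

lemma potential_rotate:
  assumes "rotation_matrix Q"
  shows "potential h (rotate_quad Q p) = potential h p"
proof -
  have "orthogonal_transformation ((*v) Q)"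
    using assms by (simp add: rotation_matrix_def orthogonal_transformation_matrix)
  then have norm: "norm (Q *v v) = norm v" for v
    by (rule orthogonal_transformation_norm)
  then have w: "weight (Q *v v) = weight v" for v
    by (simp add: weight_norm)
  have "bond (Q *v u) (Q *v v) = bond u v" for u v
    by (simp add: bond_norm w norm matrix_vector_mult_diff_distrib[symmetric])
  with w show ?thesis
    by (cases p) simp
qed

lemma riesz_eq:
  assumes "0 \<le> r" "0 < t" "r\<^sup>2 = 4 / t"
  shows "riesz s r = 4 powr (- s / 2) * t powr (s / 2)"
proof -
  have r: "r > 0"
    using assms by (metis divide_pos_pos less_eq_real_def zero_less_numeral zero_less_power2)
  have "riesz s r = (r\<^sup>2) powr (- s / 2)"
    using r powr_powr[of r 2 "- s / 2"] by (simp add: riesz_def)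
  also have "\<dots> = 4 powr (- s / 2) * t powr (s / 2)"
    unfolding assms(3) using assms(2) by (simp add: powr_divide powr_minus_divide)
  finally show ?thesis .
qed

lemma inv_stereo_components:
  "inv_stereo p $ 1 = 2 * p $ 1 / weight p" "inv_stereo p $ 2 = 2 * p $ 2 / weight p"
  "inv_stereo p $ 3 = 1 - 2 / weight p"
  using weight_pos[of p] by (simp_all add: inv_stereo_eq stereo_lift_def Let_def weight_def field_simps)

lemma norm3_square: "(norm v)\<^sup>2 = (v $ 1)\<^sup>2 + (v $ 2)\<^sup>2 + (v $ 3)\<^sup>2" for v :: "real^3"
  by (simp add: norm_vec_def L2_set_def sum_3)

lemma riesz_inv_stereo:
  assumes "p \<noteq> q"
  shows "riesz s (norm (inv_stereo p - inv_stereo q)) = 4 powr (- s / 2) * bond p q powr (s / 2)"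
proof (rule riesz_eq)
  define W V where "W = weight p" and "V = weight q"
  have WV: "W > 0" "V > 0"
    by (simp_all add: W_def V_def weight_pos)
  have "(norm (inv_stereo p - inv_stereo q))\<^sup>2 =
      (2 * p $ 1 / W - 2 * q $ 1 / V)\<^sup>2 + (2 * p $ 2 / W - 2 * q $ 2 / V)\<^sup>2 + (2 / V - 2 / W)\<^sup>2"
    by (simp add: norm3_square inv_stereo_components W_def V_def)
  also have "\<dots> = 4 * ((p $ 1 * V - q $ 1 * W)\<^sup>2 + (p $ 2 * V - q $ 2 * W)\<^sup>2 + (W - V)\<^sup>2) / (W * V)\<^sup>2"
    using WV by (simp add: field_simps power2_eq_square)
  also have "(p $ 1 * V - q $ 1 * W)\<^sup>2 + (p $ 2 * V - q $ 2 * W)\<^sup>2 + (W - V)\<^sup>2 =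
      W * V * ((p $ 1 - q $ 1)\<^sup>2 + (p $ 2 - q $ 2)\<^sup>2)"
    unfolding W_def V_def weight_def by algebra
  also have "4 * (W * V * ((p $ 1 - q $ 1)\<^sup>2 + (p $ 2 - q $ 2)\<^sup>2)) / (W * V)\<^sup>2 = 4 / bond p q"
    using WV by (simp add: bond_def W_def[symmetric] V_def[symmetric] power2_eq_square)
  finally show "(norm (inv_stereo p - inv_stereo q))\<^sup>2 = 4 / bond p q" .
qed (use assms bond_pos in auto)

lemma riesz_north_pole:
  "riesz s (norm (inv_stereo p - north_pole)) = 4 powr (- s / 2) * weight p powr (s / 2)"
proof (rule riesz_eq)
  have "(norm (inv_stereo p - north_pole))\<^sup>2 = 4 * ((p $ 1)\<^sup>2 + (p $ 2)\<^sup>2 + 1) / (weight p)\<^sup>2"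
    by (simp add: norm3_square inv_stereo_components north_pole_def power_divide power_mult_distrib
        add_divide_distrib)
  also have "(p $ 1)\<^sup>2 + (p $ 2)\<^sup>2 + 1 = weight p"
    by (simp add: weight_def)
  finally show "(norm (inv_stereo p - north_pole))\<^sup>2 = 4 / weight p"
    by (simp add: power2_eq_square)
qed (auto simp: weight_pos)

lemma energy_config:
  assumes "distinct [p0, p1, p2, p3]"
  shows "energy (riesz s) (config (p0, p1, p2, p3)) = 4 powr (- s / 2) * potential (s / 2) (p0, p1, p2, p3)"
proof -
  define xs where "xs = [inv_stereo p0, inv_stereo p1, inv_stereo p2, inv_stereo p3, north_pole]"
  have "distinct xs"
    using assms by (auto simp: xs_def inv_stereo_inject inv_stereo_neq_north_pole)
  then have inj: "inj_on ((!) xs) {..<5}"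
    by (rule inj_on_nth) (simp add: xs_def)
  have "config (p0, p1, p2, p3) = (!) xs ` {..<5}"
    by (auto simp: xs_def numeral_eq_Suc lessThan_Suc)
  then have "energy (riesz s) (config (p0, p1, p2, p3)) = (\<Sum>j<5. \<Sum>i<j. riesz s (norm (xs ! i - xs ! j)))"
    using energy_enumeration[OF inj] by simp
  also have "\<dots> = 4 powr (- s / 2) * potential (s / 2) (p0, p1, p2, p3)"
    using assms by (simp add: xs_def numeral_eq_Suc riesz_inv_stereo riesz_north_pole
        bond_commute[of p1 p2] distrib_left)
  finally show ?thesis .
qed

section \<open>Coordinates of the rotated points\<close>

text \<open>
  The aligning rotation has sine at most $24/833$, so the rotated points stay in slightly
  larger boxes. The half-length $a$ is not affected by the rotation and is computed from the original points.
  The last clause serves the equality case: the first point starts on the horizontal axis, so it can only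
  stay there if the rotation is trivial.
\<close>

lemma aligned_coordinates:
  assumes small: "small_quad (p0, p1, p2, p3)" and Q: "aligning_rotation (p0, p1, p2, p3) Q"
  obtains a b c y w x1 x3 where
    "Q *v p0 = vector [c + a, y]" "Q *v p1 = vector [x1, w - b]"
    "Q *v p2 = vector [c - a, y]" "Q *v p3 = vector [x3, w + b]"
    "a > 0" "0.661 \<le> a\<^sup>2" "a\<^sup>2 \<le> 0.9467"
    "b - w \<in> {0.68..0.9075}" "b + w \<in> {0.68..0.9075}"
    "\<bar>y\<bar> \<le> 0.0282" "\<bar>c\<bar> \<le> 0.0966" "\<bar>x1\<bar> \<le> 0.0576" "\<bar>x3\<bar> \<le> 0.0576"
    "y = 0 \<longrightarrow> Q = mat 1"
proof -
  define co si where "co = Q $ 1 $ 1" and "si = Q $ 1 $ 2"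
  have cs: "Q $ 2 $ 2 = co" "Q $ 2 $ 1 = - si" "co\<^sup>2 + si\<^sup>2 = 1"
    using Q by (simp_all add: rotation_matrix_2_iff co_def si_def)
  have comp: "(Q *v v) $ 1 = co * v $ 1 + si * v $ 2" "(Q *v v) $ 2 = co * v $ 2 - si * v $ 1" for v
    by (simp_all add: matrix_vector_mult_def sum_2 cs co_def[symmetric] si_def[symmetric])
  define u v where "u = p0 $ 1 - p2 $ 1" and "v = p2 $ 2"
  have u: "833/512 \<le> u" "u \<le> 996/512" and v: "0 \<le> v" "v \<le> 24/512" and p02: "p0 $ 2 = 0"
    using small by (auto simp: u_def v_def)
  have al: "si * u = - co * v" and gt: "co * u - si * v > 0"
    using Q by (simp_all add: comp p02 u_def v_def algebra_simps)
  have "co * (u\<^sup>2 + v\<^sup>2) = (co * u - si * v) * u + v * (si * u + co * v)"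
    by (simp add: power2_eq_square algebra_simps)
  also have "\<dots> > 0"
    using gt u al by simp
  finally have co: "co > 0"
  proof (rule zero_less_mult_pos2)
    show "u\<^sup>2 + v\<^sup>2 > 0"
      using u by (simp add: add_pos_nonneg)
  qed
  have "co\<^sup>2 \<le> 1"
    using cs(3) zero_le_power2[of si] by linarith
  then have co1: "co \<le> 1"
    using power2_le_imp_le[of co 1] by simp
  have "\<bar>si\<bar> * u = co * v"
    using al u v co by (metis abs_minus_cancel abs_mult abs_of_nonneg abs_of_pos less_le_trans minus_mult_left mult_nonneg_nonneg order_less_imp_le zero_less_divide_iff zero_less_numeral)
  also have "\<dots> \<le> 1 * (24/512)"
    using co co1 v by (intro mult_mono) auto
  finally have "\<bar>si\<bar> * (833/512) \<le> 24/512"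
    using u mult_left_mono[OF u(1), of "\<bar>si\<bar>"] by linarith
  then have si: "\<bar>si\<bar> \<le> 0.02882"
    by simp
  have "9991/10000 \<le> co\<^sup>2"
    using cs(3) square_le_of_abs_le[OF si] by (simp add: power2_eq_square)
  also have "\<dots> \<le> co"
    using co co1 by (simp add: power2_eq_square)
  finally have co2: "9991/10000 \<le> co" .

  define a b c w where "a = (co * u - si * v) / 2" and "b = ((Q *v p3) $ 2 - (Q *v p1) $ 2) / 2"
    and "c = ((Q *v p0) $ 1 + (Q *v p2) $ 1) / 2" and "w = ((Q *v p3) $ 2 + (Q *v p1) $ 2) / 2"
  have "4 * a\<^sup>2 = (co\<^sup>2 + si\<^sup>2) * (u\<^sup>2 + v\<^sup>2) - (si * u + co * v)\<^sup>2"
    unfolding a_def by (simp add: power2_eq_square field_simps)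
  then have a2: "4 * a\<^sup>2 = u\<^sup>2 + v\<^sup>2"
    using al cs(3) by simp
  have A: "0.661 \<le> a\<^sup>2" "a\<^sup>2 \<le> 0.9467"
  proof -
    have "(833/512)\<^sup>2 \<le> u\<^sup>2" "u\<^sup>2 \<le> (996/512)\<^sup>2" "v\<^sup>2 \<le> (24/512)\<^sup>2"
      using u v by (auto intro!: power_mono)
    then have "(833/512)\<^sup>2 \<le> 4 * a\<^sup>2" "4 * a\<^sup>2 \<le> (996/512)\<^sup>2 + (24/512)\<^sup>2"
      unfolding a2 by (simp_all add: add_increasing2)
    then show "0.661 \<le> a\<^sup>2" "a\<^sup>2 \<le> 0.9467"
      by (simp_all add: power_divide)
  qed
  have coabs: "\<bar>co\<bar> \<le> 1"
    using co co1 by simp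

  have col: "\<bar>(Q *v p) $ 1\<bar> \<le> 0.0576"
    if "\<bar>p $ 1\<bar> \<le> 16/512" "\<bar>p $ 2\<bar> \<le> 464/512" for p
    using abs_mult_le[OF coabs that(1)] abs_mult_le[OF si that(2)] unfolding comp abs_le_iff by simp
  have z: "(Q *v p) $ 2 \<in> {0.68..0.9075}"
    if "\<bar>p $ 1\<bar> \<le> 16/512" "349/512 \<le> p $ 2" "p $ 2 \<le> 464/512" for p
  proof -
    have "9991/10000 * (349/512) \<le> co * p $ 2" "co * p $ 2 \<le> 1 * (464/512)"
      by (intro mult_mono; use co co1 co2 that in linarith)+
    then show ?thesis
      using abs_mult_le[OF si that(1)] unfolding comp abs_le_iff by simp
  qed
  have p13: "\<bar>p1 $ 1\<bar> \<le> 16/512" "\<bar>p3 $ 1\<bar> \<le> 16/512" "- 464/512 \<le> p1 $ 2" "p1 $ 2 \<le> - 349/512"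
    "349/512 \<le> p3 $ 2" "p3 $ 2 \<le> 464/512"
    using small by (auto simp: abs_le_iff)
  show thesis
  proof (rule that)
    show "Q *v p0 = vector [c + a, - si * p0 $ 1]" "Q *v p2 = vector [c - a, - si * p0 $ 1]"
      using al by (simp_all add: vec_eq_iff forall_2 a_def c_def comp p02 u_def v_def field_simps)
    show "Q *v p1 = vector [(Q *v p1) $ 1, w - b]" "Q *v p3 = vector [(Q *v p3) $ 1, w + b]"
      by (simp_all add: vec_eq_iff forall_2 w_def b_def field_simps)
    show "a > 0"
      using gt by (simp add: a_def)
    show "0.661 \<le> a\<^sup>2" "a\<^sup>2 \<le> 0.9467"
      by fact+
    have "(Q *v (- p1)) $ 2 \<in> {0.68..0.9075}"
      using p13 by (intro z) auto
    then show "b - w \<in> {0.68..0.9075}"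
      by (simp add: b_def w_def comp field_simps)
    have "(Q *v p3) $ 2 \<in> {0.68..0.9075}"
      using p13 by (intro z) auto
    then show "b + w \<in> {0.68..0.9075}"
      by (simp add: b_def w_def field_simps)
    have "\<bar>p0 $ 1\<bar> \<le> 498/512"
      using small by auto
    from abs_mult_le[OF si this] show "\<bar>- si * p0 $ 1\<bar> \<le> 0.0282"
      by simp
    have "\<bar>p0 $ 1 + p2 $ 1\<bar> \<le> 98/512" "\<bar>v\<bar> \<le> 24/512"
      using small v unfolding abs_le_iff by auto
    then have "\<bar>co * (p0 $ 1 + p2 $ 1)\<bar> \<le> 1 * (98/512)" "\<bar>si * v\<bar> \<le> 0.02882 * (24/512)"
      using abs_mult_le[OF coabs] abs_mult_le[OF si] by blast+
    moreover have "2 * c = co * (p0 $ 1 + p2 $ 1) + si * v"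
      by (simp add: c_def comp p02 v_def distrib_left)
    ultimately show "\<bar>c\<bar> \<le> 0.0966"
      unfolding abs_le_iff by simp
    show "\<bar>(Q *v p1) $ 1\<bar> \<le> 0.0576" "\<bar>(Q *v p3) $ 1\<bar> \<le> 0.0576"
      using col[of p1] col[of p3] p13 unfolding abs_le_iff[of "_ $ 2"] by simp_all
    show "- si * p0 $ 1 = 0 \<longrightarrow> Q = mat 1"
    proof
      assume "- si * p0 $ 1 = 0"
      then have "si = 0"
        using small by auto
      moreover from this have "co = 1"
        using cs(3) co by (simp add: power2_eq_1_iff)
      ultimately show "Q = mat 1"
        using cs by (simp add: vec_eq_iff forall_2 mat_def co_def[symmetric] si_def[symmetric])
    qed
  qed
qed

section \<open>Symmetrization lowers the energy\<close>

theorem lemma2p3p1: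
  fixes s :: real and X :: "(real^3) set"
  assumes "s \<in> {12..15 + 25/512}"
    and "X \<in> SMALL"
  shows "energy (riesz s) (star X) \<le> energy (riesz s) X \<and>
         (energy (riesz s) (star X) = energy (riesz s) X \<longleftrightarrow> X = star X)"
proof -
  obtain p0 p1 p2 p3 where small: "small_quad (p0, p1, p2, p3)" and X: "X = config (p0, p1, p2, p3)"
    using assms(2) by (auto simp: SMALL_def)
  let ?p = "(p0, p1, p2, p3)"
  define Q where "Q = (THE Q. aligning_rotation ?p Q)"
  have Q: "aligning_rotation ?p Q"
    unfolding Q_def by (rule theI'[OF aligning_rotation_ex1[OF small]])
  obtain a b c y w x1 x3 where rot:
    "Q *v p0 = vector [c + a, y]" "Q *v p1 = vector [x1, w - b]"
    "Q *v p2 = vector [c - a, y]" "Q *v p3 = vector [x3, w + b]"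
    and a: "a > 0" and A: "0.661 \<le> a\<^sup>2" "a\<^sup>2 \<le> 0.9467"
    and z: "b - w \<in> {0.68..0.9075}" "b + w \<in> {0.68..0.9075}"
    and y: "\<bar>y\<bar> \<le> 0.0282" and c: "\<bar>c\<bar> \<le> 0.0966" and x: "\<bar>x1\<bar> \<le> 0.0576" "\<bar>x3\<bar> \<le> 0.0576"
    and y0: "y = 0 \<longrightarrow> Q = mat 1"
    by (rule aligned_coordinates[OF small Q])
  define \<alpha> \<beta> :: "real^2" where "\<alpha> = vector [a, 0]" and "\<beta> = vector [0, - b]"
  have star_p: "star_quad ?p = (\<alpha>, \<beta>, - \<alpha>, - \<beta>)"
    unfolding star_quad_def Q_def[symmetric] by (simp add: rot Let_def \<alpha>_def \<beta>_def)
  have starX: "star X = config (\<alpha>, \<beta>, - \<alpha>, - \<beta>)"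
    unfolding X star_config[OF small] star_p ..
  have b: "b > 0"
    using z by auto

  define h where "h = s / 2"
  have h: "6 \<le> h" "h \<le> 38/5"
    using assms(1) by (auto simp: h_def)
  define \<kappa> where "\<kappa> = 4 powr (- s / 2)"
  have \<kappa>: "\<kappa> > 0"
    by (simp add: \<kappa>_def)
  have "distinct [p0, p1, p2, p3]"
    using small by auto
  then have EX: "energy (riesz s) X = \<kappa> * potential h ?p"
    unfolding X \<kappa>_def h_def by (rule energy_config)
  have "distinct [\<alpha>, \<beta>, - \<alpha>, - \<beta>]"
    using a b by (auto simp: \<alpha>_def \<beta>_def vec_eq_iff forall_2)
  then have ES: "energy (riesz s) (star X) = \<kappa> * potential h (\<alpha>, \<beta>, - \<alpha>, - \<beta>)"
    unfolding starX \<kappa>_def h_def by (rule energy_config)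

  define gap where "gap = h * ((1 + a\<^sup>2) powr (h - 1) * ((c\<^sup>2 + y\<^sup>2) / 5) + (1 + b\<^sup>2) powr (h - 1) * ((w\<^sup>2 + x1\<^sup>2 + x3\<^sup>2) / 100))"
  have "potential h (\<alpha>, \<beta>, - \<alpha>, - \<beta>) + gap \<le> potential h (rotate_quad Q ?p)"
    unfolding \<alpha>_def \<beta>_def potential_rhombus[OF a b] gap_def rotate_quad.simps rot
    by (rule potential_gap[OF h A z y c x])
  then have gap: "potential h (\<alpha>, \<beta>, - \<alpha>, - \<beta>) + gap \<le> potential h ?p"
    using Q by (simp only: potential_rotate aligning_rotation.simps)
  have gap0: "gap \<ge> 0"
    using h by (simp add: gap_def)
  have le: "energy (riesz s) (star X) \<le> energy (riesz s) X"
    unfolding EX ES using gap gap0 \<kappa> by simp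
  have "X = star X" if "energy (riesz s) (star X) = energy (riesz s) X"
  proof -
    have "gap = 0"
      using that gap gap0 \<kappa> unfolding EX ES by simp
    moreover have "(1 + a\<^sup>2) powr (h - 1) > 0" "(1 + b\<^sup>2) powr (h - 1) > 0"
      by (simp_all add: add_nonneg_eq_0_iff)
    moreover have "(1 + a\<^sup>2) powr (h - 1) * ((c\<^sup>2 + y\<^sup>2) / 5) \<ge> 0" "(1 + b\<^sup>2) powr (h - 1) * ((w\<^sup>2 + x1\<^sup>2 + x3\<^sup>2) / 100) \<ge> 0"
      by simp_all
    ultimately have "(c\<^sup>2 + y\<^sup>2) / 5 = 0" "(w\<^sup>2 + x1\<^sup>2 + x3\<^sup>2) / 100 = 0"
      using h by (simp_all only: gap_def mult_eq_0_iff add_nonneg_eq_0_iff) auto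
    then have zero: "c = 0" "y = 0" "w = 0" "x1 = 0" "x3 = 0"
      by (simp_all add: add_nonneg_eq_0_iff)
    with y0 have "Q = mat 1"
      by simp
    with rot zero have "?p = (\<alpha>, \<beta>, - \<alpha>, - \<beta>)"
      by (simp add: \<alpha>_def \<beta>_def matrix_vector_mul_lid) (simp add: vec_eq_iff forall_2)
    then show ?thesis
      by (simp only: starX) (simp only: X)
  qed
  with le show ?thesis
    by auto
qed

end
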